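(* Let $|q|<1$ and let $f(-q)=(q;q)_\infty=\prod_{k\ge 1}(1-q^k)$. Set $$P=\frac{q^{1/2}f(-q)f(-q^{26})}{f(-q^{2})f(-q^{13})},\qquad Q=\frac{q\,f(-q^{2})f(-q^{52})}{f(-q^{4})f(-q^{26})}.$$ Then $$\left(PQ+\frac{1}{PQ}\right)^2=\left(PQ+\frac{1}{PQ}\right)\left(\left(\frac{P}{Q}+\frac{Q}{P}\right)^3+\left(\frac{P}{Q}+\frac{Q}{P}\right)\right)-4\left(\frac{P}{Q}+\frac{Q}{P}\right)^2+4.$$
   Context: $(a;q)_\infty=\prod_{n\ge0}(1-aq^n)$. Fractional powers of $q$ are taken consistently, e.g. writing $q=e^{2\pi i\tau}$ with $\operatorname{Im}\tau>0$ and $q^r=e^{2\pi i r\tau}$. *)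

theory Defs
  imports "HOL-Analysis.Analysis"
begin

definition qpochhammer_inf :: "complex \<Rightarrow> complex \<Rightarrow> complex" where
  "qpochhammer_inf a q = (\<Prod>n. 1 - a * q ^ n)"

(* The argument is z = - q, so that f(-q) = (q; q)_inf reads ramanujan_f (- q). *)
definition ramanujan_f :: "complex \<Rightarrow> complex" where
  "ramanujan_f z = qpochhammer_inf (- z) (- z)"

(* q^r for q = exp (2 pi i tau). The power depends on tau and not only on q: the
   principal branch q powr r would give another value for some tau. *)
definition q_power :: "complex \<Rightarrow> real \<Rightarrow> complex" where
  "q_power \<tau> r = exp (2 * of_real pi * \<i> * of_real r * \<tau>)"

end

theory Submission
  imports Defs "HOL-Complex_Analysis.Complex_Analysis"
begin

text \<open>
  Write \<open>h(\<tau>) = (\<eta>(\<tau>) / \<eta>(13\<tau>))\<^sup>2\<close>. Then \<open>P\<^sup>2 = h(\<tau>) / h(2\<tau>)\<close> and \<open>Q\<^sup>2 = h(2\<tau>) / h(4\<tau>)\<close>, and the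
  claim follows by eliminating \<open>h(2\<tau>)\<close> from two instances of Ramanujan's modular equation of
  degree 2 between \<open>s = h(\<tau>)\<close> and \<open>u = h(2\<tau>)\<close>,
  \<open>s\<^sup>2u\<^sup>2 + 13su - u\<^sup>3 - s\<^sup>3 + 4su(s + u) = 0\<close>: the resultant is the claimed polynomial times
  \<open>(1 - P\<^sup>2Q\<^sup>2)\<^sup>2\<close>, and the second factor does not vanish identically.

  The degree 2 equation is proved by the maximum principle. The product of its left-hand side
  (suitably scaled) over the three transforms \<open>2\<tau>\<close>, \<open>\<tau>/2\<close>, \<open>(\<tau> + 1)/2\<close> is invariant under \<open>\<Gamma>\<^sub>0(13)\<close> and
  the Fricke involution and tends to 0 at the cusp. Since finitely many explicit elements move every
  point to height at least \<open>1/20\<close>, its modulus attains a maximum, so it is constant and hence 0.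
  The transformation law of \<open>\<eta>\<^sup>2\<close> comes from a theta function: Liouville's theorem gives its
  inversion formula up to a constant, and Euler's identity evaluates that constant at the half
  periods.
\<close>

subsection \<open>The infinite q-Pochhammer symbol\<close>

lemma qpochhammer_has_prod:
  assumes "norm q < 1"
  shows "(\<lambda>n. 1 - a * q ^ n) has_prod qpochhammer_inf a q"
proof -
  have "summable (\<lambda>n. norm a * norm q ^ n)"
    using assms by (intro summable_mult summable_geometric) simp
  then have "summable (\<lambda>n. norm ((1 - a * q ^ n) - 1))"
    by (simp add: norm_mult norm_power)
  then have "abs_convergent_prod (\<lambda>n. 1 - a * q ^ n)"
    by (rule summable_imp_abs_convergent_prod)
  then show ?thesis
    unfolding qpochhammer_inf_def
    by (intro convergent_prod_has_prod abs_convergent_prod_imp_convergent_prod)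
qed

lemma qpochhammer_tendsto:
  assumes "norm q < 1"
  shows "(\<lambda>n. \<Prod>k<n. 1 - a * q ^ k) \<longlonglongrightarrow> qpochhammer_inf a q"
  using has_prod_imp_tendsto'[OF qpochhammer_has_prod[OF assms]] .

lemma qpochhammer_eq_0_iff:
  assumes "norm q < 1"
  shows "qpochhammer_inf a q = 0 \<longleftrightarrow> (\<exists>n. a * q ^ n = 1)"
  using has_prod_eq_0_iff[OF qpochhammer_has_prod[OF assms, of a]]
  by (auto simp: image_iff)

lemma qpochhammer_nonzero:
  assumes "norm q < 1" "norm a < 1"
  shows "qpochhammer_inf a q \<noteq> 0"
proof -
  have "norm (a * q ^ n) < 1" for n
  proof -
    have "norm q ^ n \<le> 1" using assms by (simp add: power_le_one)
    then have "norm a * norm q ^ n \<le> norm a * 1" by (intro mult_left_mono) auto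
    then show ?thesis using assms by (simp add: norm_mult norm_power)
  qed
  then show ?thesis
    using assms by (subst qpochhammer_eq_0_iff) (auto, metis norm_one less_irrefl)
qed

lemma qpochhammer_shift:
  assumes "norm q < 1"
  shows "qpochhammer_inf a q = (1 - a) * qpochhammer_inf (a * q) q"
proof -
  have "(\<lambda>n. 1 - a * q ^ Suc n) has_prod qpochhammer_inf (a * q) q"
    using qpochhammer_has_prod[OF assms, of "a * q"] by (simp add: mult_ac)
  from has_prod_Suc_imp[where f = "\<lambda>n. 1 - a * q ^ n", OF this] have "(\<lambda>n. 1 - a * q ^ n) has_prod (qpochhammer_inf (a * q) q * (1 - a))"
    by simp
  then show ?thesis
    using has_prod_unique2[OF qpochhammer_has_prod[OF assms]] by (simp add: mult.commute)
qed

lemma qpochhammer_mult_uminus: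
  assumes "norm q < 1"
  shows "qpochhammer_inf a q * qpochhammer_inf (- a) q = qpochhammer_inf (a\<^sup>2) (q\<^sup>2)"
proof -
  have q2: "norm (q\<^sup>2) < 1" using assms by (simp add: norm_power power_less_one_iff)
  have "(1 - a * q ^ n) * (1 - - a * q ^ n) = 1 - a\<^sup>2 * q\<^sup>2 ^ n" for n
    by (simp add: algebra_simps power2_eq_square power_mult_distrib)
  then have "(\<lambda>n. 1 - a\<^sup>2 * q\<^sup>2 ^ n) has_prod (qpochhammer_inf a q * qpochhammer_inf (- a) q)"
    using has_prod_mult[OF qpochhammer_has_prod[OF assms, of a] qpochhammer_has_prod[OF assms, of "-a"]]
    by simp
  then show ?thesis
    using has_prod_unique2[OF _ qpochhammer_has_prod[OF q2]] by blast
qed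

lemma qpochhammer_even_odd:
  assumes "norm q < 1"
  shows "qpochhammer_inf a q = qpochhammer_inf a (q\<^sup>2) * qpochhammer_inf (a * q) (q\<^sup>2)"
proof (rule LIMSEQ_unique)
  have q2: "norm (q\<^sup>2) < 1" using assms by (simp add: norm_power power_less_one_iff)
  have "(\<Prod>k<2*n. 1 - a * q ^ k) = (\<Prod>k<n. 1 - a * q\<^sup>2 ^ k) * (\<Prod>k<n. 1 - a * q * q\<^sup>2 ^ k)" for n
    by (induction n) (simp_all add: power_mult [symmetric] mult_ac)
  then show "(\<lambda>n. \<Prod>k<2*n. 1 - a * q ^ k) \<longlonglongrightarrow> qpochhammer_inf a (q\<^sup>2) * qpochhammer_inf (a * q) (q\<^sup>2)"
    using tendsto_mult[OF qpochhammer_tendsto[OF q2, of a] qpochhammer_tendsto[OF q2, of "a * q"]]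
    by simp
  show "(\<lambda>n. \<Prod>k<2*n. 1 - a * q ^ k) \<longlonglongrightarrow> qpochhammer_inf a q"
    using LIMSEQ_subseq_LIMSEQ[OF qpochhammer_tendsto[OF assms, of a], of "\<lambda>n. 2 * n"]
    by (simp add: strict_mono_def o_def)
qed

text \<open>Pairing the factors of \<open>(q; q)\<close> and \<open>(-q; q)\<close> gives
  \<open>(q^2; q^2)\<close>, while splitting \<open>(q; q)\<close> by parity exhibits the same
  nonzero product as a factor, so it cancels.\<close>

lemma qpochhammer_euler:
  assumes "norm q < 1"
  shows "qpochhammer_inf (- q) q * qpochhammer_inf q (q\<^sup>2) = 1"
proof -
  have q2: "norm (q\<^sup>2) < 1" using assms by (simp add: norm_power power_less_one_iff)
  have "qpochhammer_inf q (q\<^sup>2) * qpochhammer_inf (q\<^sup>2) (q\<^sup>2) * qpochhammer_inf (- q) q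
      = qpochhammer_inf (q\<^sup>2) (q\<^sup>2)"
    using qpochhammer_even_odd[OF assms, of q] qpochhammer_mult_uminus[OF assms, of q]
    by (simp add: power2_eq_square)
  moreover have "qpochhammer_inf (q\<^sup>2) (q\<^sup>2) \<noteq> 0"
    using q2 by (intro qpochhammer_nonzero)
  ultimately show ?thesis by (simp add: mult_ac)
qed

lemma qpochhammer_0_0 [simp]: "qpochhammer_inf 0 0 = 1"
  by (simp add: qpochhammer_inf_def)

text \<open>On a compact ball \<open>a\<close> is bounded and \<open>|q|\<close> attains a maximum
  below 1, so a geometric series dominates. The conclusion has the shape that
  \<open>holomorphic_uniform_sequence\<close> asks for.\<close>

lemma qpochhammer_locally_uniform_limit:
  assumes S: "open S" and x: "x \<in> S" and a: "a holomorphic_on S" and q: "q holomorphic_on S"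
    and lt: "\<And>z. z \<in> S \<Longrightarrow> norm (q z) < 1"
  shows "\<exists>d>0. cball x d \<subseteq> S \<and> uniform_limit (cball x d) (\<lambda>N z. \<Prod>k<N. 1 - a z * q z ^ k)
      (\<lambda>z. qpochhammer_inf (a z) (q z)) sequentially"
proof -
  obtain d where d: "d > 0" "cball x d \<subseteq> S"
    using S x open_contains_cball by blast
  let ?B = "cball x d"
  have ca: "continuous_on ?B a" and cq: "continuous_on ?B q"
    using continuous_on_subset[OF holomorphic_on_imp_continuous_on d(2)] a q by auto
  have "\<exists>A. \<forall>z\<in>?B. norm (a z) \<le> A"
    using compact_imp_bounded[OF compact_continuous_image[OF ca]] by (auto simp: bounded_iff)
  then obtain A where A: "\<And>z. z \<in> ?B \<Longrightarrow> norm (a z) \<le> A" by blast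
  have "\<exists>m\<in>?B. \<forall>z\<in>?B. norm (q z) \<le> norm (q m)"
    using d by (intro continuous_attains_sup) (auto intro!: continuous_on_norm cq)
  then obtain m where m: "m \<in> ?B" "\<And>z. z \<in> ?B \<Longrightarrow> norm (q z) \<le> norm (q m)" by blast
  have r: "norm (q m) < 1" using lt m d by blast
  have le: "norm (norm ((1 - a z * q z ^ n) - 1)) \<le> A * norm (q m) ^ n" if "z \<in> ?B" for z n
  proof -
    have "norm (a z) * norm (q z) ^ n \<le> A * norm (q m) ^ n"
      using A[OF that] m(2)[OF that] order_trans[OF norm_ge_zero A[OF that]]
      by (intro mult_mono power_mono) auto
    then show ?thesis by (simp add: norm_mult norm_power)
  qed
  have "uniformly_convergent_on ?B (\<lambda>N z. \<Sum>n<N. norm ((1 - a z * q z ^ n) - 1))"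
  proof (rule Weierstrass_m_test'[where M = "\<lambda>n. A * norm (q m) ^ n"])
    show "norm (norm ((1 - a z * q z ^ n) - 1)) \<le> A * norm (q m) ^ n" if "z \<in> ?B" for n z
      using le that by blast
    show "summable (\<lambda>n. A * norm (q m) ^ n)"
      using r by (intro summable_mult summable_geometric) simp
  qed
  then have "uniformly_convergent_on ?B (\<lambda>N z. \<Prod>n<N. 1 - a z * q z ^ n)"
    by (intro uniformly_convergent_on_prod'[where f = "\<lambda>n z. 1 - a z * q z ^ n"])
      (auto intro!: continuous_on_diff continuous_on_mult continuous_on_power ca cq)
  then obtain l where l: "uniform_limit ?B (\<lambda>N z. \<Prod>n<N. 1 - a z * q z ^ n) l sequentially"
    unfolding uniformly_convergent_on_def by (elim exE)
  have "l z = qpochhammer_inf (a z) (q z)" if "z \<in> ?B" for z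
    by (rule LIMSEQ_unique[OF tendsto_uniform_limitI[OF l that] qpochhammer_tendsto])
      (use lt d that in auto)
  then have "uniform_limit ?B (\<lambda>N z. \<Prod>n<N. 1 - a z * q z ^ n)
      (\<lambda>z. qpochhammer_inf (a z) (q z)) sequentially"
    by (intro uniform_limit_cong'[THEN iffD1, OF _ _ l] refl)
  then show ?thesis
    using d by (intro exI[of _ d] conjI)
qed

lemma qpochhammer_holomorphic:
  assumes S: "open S" and a: "a holomorphic_on S" and q: "q holomorphic_on S"
    and lt: "\<And>z. z \<in> S \<Longrightarrow> norm (q z) < 1"
  shows "(\<lambda>z. qpochhammer_inf (a z) (q z)) holomorphic_on S"
proof (rule holomorphic_uniform_sequence[OF S])
  show "(\<lambda>z. \<Prod>k<n. 1 - a z * q z ^ k) holomorphic_on S" for n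
    by (intro holomorphic_on_prod holomorphic_on_diff holomorphic_on_mult holomorphic_on_power
        holomorphic_on_const a q)
qed (rule qpochhammer_locally_uniform_limit[OF S _ a q lt])

text \<open>Termwise logarithmic differentiation: at 0 the factor \<open>1 - q^(k+1)\<close> has
  derivative 0 unless \<open>k = 0\<close>. This first-order term decides the cancellation at the
  cusp later.\<close>

lemma qpochhammer_diagonal_has_field_derivative_0:
  "((\<lambda>q. qpochhammer_inf q q) has_field_derivative - 1) (at 0)"
proof -
  let ?P = "\<lambda>q. qpochhammer_inf q q"
  have "\<exists>d>0. cball (0::complex) d \<subseteq> ball 0 1 \<and> uniform_limit (cball 0 d) (\<lambda>N z. \<Prod>k<N. 1 - z * z ^ k) ?P sequentially"
    using qpochhammer_locally_uniform_limit[of "ball 0 1" 0 "\<lambda>z. z" "\<lambda>z. z"]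
    by (simp add: holomorphic_on_ident)
  then obtain d where d: "d > 0"
    "uniform_limit (cball 0 d) (\<lambda>N z. \<Prod>k<N. 1 - z * z ^ k) ?P sequentially" by auto
  have lim: "uniform_limit (ball 0 d) (\<lambda>N z. \<Prod>k<N. 1 - z * z ^ k) ?P sequentially"
    by (rule uniform_limit_on_subset[OF d(2)]) auto
  have "(\<lambda>k. deriv (\<lambda>z::complex. 1 - z * z ^ k) 0 / (1 - 0 * 0 ^ k)) sums (deriv ?P 0 / ?P 0)"
    by (rule logderiv_prodinf_complex_uniform_limit[OF lim])
      (use d in \<open>auto intro!: holomorphic_intros\<close>)
  moreover have "deriv (\<lambda>z::complex. 1 - z * z ^ k) 0 = (if k = 0 then - 1 else 0)" for k
    by (rule DERIV_imp_deriv) (auto intro!: derivative_eq_intros)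
  ultimately have "(\<lambda>k. if k = 0 then - 1 else 0) sums deriv ?P 0"
    by simp
  then have "deriv ?P 0 = - 1"
    by (rule sums_unique2[OF _ sums_single[of 0 "\<lambda>_. - 1 :: complex"]])
  moreover have "?P holomorphic_on ball 0 1"
    by (intro qpochhammer_holomorphic holomorphic_on_ident) auto
  ultimately show ?thesis
    by (metis open_ball centre_in_ball holomorphic_derivI zero_less_one)
qed

subsection \<open>Elliptic functions\<close>

definition nome :: "complex \<Rightarrow> complex" where
  "nome z = exp (2 * of_real pi * \<i> * z)"

lemma nome_0 [simp]: "nome 0 = 1" and nome_1 [simp]: "nome 1 = 1"
  by (simp_all add: nome_def mult.commute)

lemma nome_nonzero [simp]: "nome z \<noteq> 0"
  by (simp add: nome_def)

lemma nome_add: "nome (z + w) = nome z * nome w"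
  by (simp add: nome_def exp_add ring_distribs)

lemma nome_diff: "nome (z - w) = nome z / nome w"
  by (simp add: nome_def exp_diff ring_distribs)

lemma nome_minus: "nome (- z) = 1 / nome z"
  using nome_diff[of 0 z] by simp

lemma nome_half [simp]: "nome (1 / 2) = - 1"
  by (simp add: nome_def exp_eq_polar mult.commute)

lemma nome_quarter: "nome (1 / 4) = \<i>"
  by (simp add: nome_def complex_eq_iff Re_exp Im_exp)

lemma nome_power: "nome z ^ n = nome (of_nat n * z)"
  by (simp add: nome_def exp_of_nat_mult [symmetric] mult_ac)

lemma nome_of_int [simp]: "nome (of_int n) = 1"
  by (auto simp: nome_def exp_eq_1 intro!: exI[of _ n])

lemma nome_plus1 [simp]: "nome (z + 1) = nome z"
  by (simp add: nome_add)

lemma nome_eq_1_iff: "nome z = 1 \<longleftrightarrow> z \<in> \<int>"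
proof
  assume "nome z = 1"
  then obtain n :: int where "Im z = 0" "Re z = of_int n"
    by (auto simp: nome_def exp_eq_1 field_simps)
  then have "z = of_int n" by (simp add: complex_eq_iff)
  then show "z \<in> \<int>" by simp
qed (auto elim: Ints_cases)

lemma norm_nome: "norm (nome z) = exp (- 2 * pi * Im z)"
  by (simp add: nome_def)

lemma norm_nome_less_1 [simp]: "norm (nome z) < 1 \<longleftrightarrow> Im z > 0"
  by (simp add: norm_nome mult_less_0_iff zero_less_mult_iff)

lemma nome_holomorphic [holomorphic_intros]:
  "f holomorphic_on S \<Longrightarrow> (\<lambda>z. nome (f z)) holomorphic_on S"
  unfolding nome_def by (intro holomorphic_intros)

text \<open>In the basis 1, \<tau> this is the set of points with both real coordinates below
  \<open>r\<close> in modulus. For \<open>r = 1\<close> and \<tau> in the upper half plane, 0 is its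
  only lattice point.\<close>

definition period_parallelogram :: "complex \<Rightarrow> real \<Rightarrow> complex set" where
  "period_parallelogram \<tau> r =
     {w. \<bar>Im w / Im \<tau>\<bar> < r \<and> \<bar>Re w - Im w / Im \<tau> * Re \<tau>\<bar> < r}"

lemma open_period_parallelogram: "open (period_parallelogram \<tau> r)"
  unfolding period_parallelogram_def divide_inverse
  by (intro open_Collect_conj open_Collect_less continuous_intros)

lemma bounded_period_parallelogram:
  assumes "Im \<tau> > 0"
  shows "bounded (period_parallelogram \<tau> r)"
proof (rule boundedI)
  fix w assume w: "w \<in> period_parallelogram \<tau> r"
  define y where "y = Im w / Im \<tau>"
  have y: "\<bar>y\<bar> < r" "\<bar>Re w - y * Re \<tau>\<bar> < r" "Im w = y * Im \<tau>"
    using w assms by (auto simp: period_parallelogram_def y_def)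
  have r: "r > 0" using y by linarith
  have 1: "\<bar>y * c\<bar> \<le> r * \<bar>c\<bar>" for c
    unfolding abs_mult using y by (intro mult_right_mono) auto
  have "norm w \<le> \<bar>Re w\<bar> + \<bar>Im w\<bar>" by (rule cmod_le)
  also have "\<bar>Re w\<bar> \<le> r + r * \<bar>Re \<tau>\<bar>" using 1[of "Re \<tau>"] y by linarith
  also have "\<bar>Im w\<bar> \<le> r * \<bar>Im \<tau>\<bar>" using 1[of "Im \<tau>"] y by simp
  finally show "norm w \<le> r + r * \<bar>Re \<tau>\<bar> + r * \<bar>Im \<tau>\<bar>" by simp
qed

text \<open>Rounding the two lattice coordinates leaves at most 1/2 of each; 3/4 lies strictly
  between this and the 1 of the parallelogram on which holomorphy is assumed below.\<close>

lemma lattice_translate: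
  assumes "Im \<tau> > 0"
  obtains m n :: int where "z - (of_int m + of_int n * \<tau>) \<in> period_parallelogram \<tau> (3/4)"
proof -
  define y where "y = Im z / Im \<tau>"
  define x where "x = Re z - y * Re \<tau>"
  have "\<bar>y - of_int (round y)\<bar> < 3/4" "\<bar>x - of_int (round x)\<bar> < 3/4"
    using of_int_round_abs_le[of y] of_int_round_abs_le[of x] by linarith+
  moreover have "Im (z - (of_int (round x) + of_int (round y) * \<tau>)) / Im \<tau> = y - of_int (round y)"
    using assms by (simp add: y_def field_simps)
  moreover have "Re (z - (of_int (round x) + of_int (round y) * \<tau>)) - (y - of_int (round y)) * Re \<tau>
      = x - of_int (round x)"
    using assms by (simp add: x_def algebra_simps)
  ultimately show thesis
    by (intro that[of "round x" "round y"]) (simp only: period_parallelogram_def mem_Collect_eq)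
qed

text \<open>Every point has a lattice translate in the parallelogram, so periodicity carries
  holomorphy to the whole plane and boundedness over from a compact set; then Liouville applies.
  With the hypothesis restricted to the parallelogram, a single possible pole remains to be
  examined.\<close>

lemma elliptic_holomorphic_imp_constant:
  assumes \<tau>: "Im \<tau> > 0"
    and hol: "g holomorphic_on period_parallelogram \<tau> 1"
    and p1: "\<And>z. g (z + 1) = g z" and p\<tau>: "\<And>z. g (z + \<tau>) = g z"
  shows "\<exists>c. \<forall>z. g z = c"
proof -
  have shift: "g (z + of_int n * p) = g z" if "\<And>z. g (z + p) = g z" for z p and n :: int
  proof (induction n rule: int_induct[where k = 0])
    case (step1 i)
    then show ?case using that[of "z + of_int i * p"] by (simp add: algebra_simps)
  next
    case (step2 i)
    then show ?case using that[of "z + of_int (i - 1) * p"] by (simp add: algebra_simps)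
  qed simp
  have per: "g (z - (of_int m + of_int n * \<tau>)) = g z" for z and m n :: int
    using shift[of 1 "z - (of_int m + of_int n * \<tau>)" m]
      shift[of \<tau> "z - of_int n * \<tau>" n] p1 p\<tau>
    by (simp add: algebra_simps)
  have dif: "g field_differentiable at z" for z
  proof -
    obtain m n :: int where "z - (of_int m + of_int n * \<tau>) \<in> period_parallelogram \<tau> (3/4)"
      using lattice_translate[OF \<tau>] .
    moreover have "period_parallelogram \<tau> (3/4) \<subseteq> period_parallelogram \<tau> 1"
      unfolding period_parallelogram_def by (rule Collect_mono) linarith
    ultimately have "z - (of_int m + of_int n * \<tau>) \<in> period_parallelogram \<tau> 1"
      by blast
    then have *: "g field_differentiable at (z - (of_int m + of_int n * \<tau>))"
      using hol open_period_parallelogram holomorphic_on_imp_differentiable_at by blast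
    have "(g \<circ> (\<lambda>z. z - (of_int m + of_int n * \<tau>))) field_differentiable at z"
      using * by (intro field_differentiable_compose) (auto intro!: derivative_intros)
    moreover have "g \<circ> (\<lambda>z. z - (of_int m + of_int n * \<tau>)) = g"
      using per by (auto simp: fun_eq_iff)
    ultimately show ?thesis by simp
  qed
  have hol': "g holomorphic_on UNIV"
    using dif by (simp add: holomorphic_on_open field_differentiable_def)
  have "compact (closure (period_parallelogram \<tau> (3/4)))"
    using bounded_period_parallelogram[OF \<tau>] by simp
  then have "bounded (g ` closure (period_parallelogram \<tau> (3/4)))"
    using continuous_on_subset[OF holomorphic_on_imp_continuous_on[OF hol']]
    by (intro compact_imp_bounded compact_continuous_image) auto
  moreover have "range g \<subseteq> g ` closure (period_parallelogram \<tau> (3/4))"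
  proof safe
    fix z
    obtain m n :: int where "z - (of_int m + of_int n * \<tau>) \<in> period_parallelogram \<tau> (3/4)"
      using lattice_translate[OF \<tau>] .
    then show "g z \<in> g ` closure (period_parallelogram \<tau> (3/4))"
      using per closure_subset by (metis image_eqI subsetD)
  qed
  ultimately have "g constant_on UNIV"
    using Liouville_theorem[OF hol'] bounded_subset by blast
  then show ?thesis by (simp add: constant_on_def)
qed

subsection \<open>A theta function and the inversion of the eta function\<close>

text \<open>The part of the Jacobi product that does not vanish at the origin, kept apart so that
  limits at 0 can be taken.\<close>

definition theta_cofactor :: "complex \<Rightarrow> complex \<Rightarrow> complex" where
  "theta_cofactor \<tau> z =
     qpochhammer_inf (nome (\<tau> + z)) (nome \<tau>) * qpochhammer_inf (nome (\<tau> - z)) (nome \<tau>)"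

text \<open>Jacobi's odd theta function without its factor \<open>\<i> q\<^bsup>1/8\<^esup> (q; q)\<^sub>\<infinity>\<close>, which keeps its values at the
  half periods elementary.\<close>

definition theta :: "complex \<Rightarrow> complex \<Rightarrow> complex" where
  "theta \<tau> z = (nome (- z / 2) - nome (z / 2)) * theta_cofactor \<tau> z"

lemma theta_cofactor_holomorphic:
  assumes "Im \<tau> > 0"
  shows "theta_cofactor \<tau> holomorphic_on UNIV"
  unfolding theta_cofactor_def
  by (intro holomorphic_on_mult qpochhammer_holomorphic holomorphic_intros) (use assms in auto)

lemma theta_holomorphic:
  assumes "Im \<tau> > 0"
  shows "theta \<tau> holomorphic_on UNIV"
  unfolding theta_def by (intro holomorphic_intros theta_cofactor_holomorphic assms) auto

lemma theta_0 [simp]: "theta \<tau> 0 = 0"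
  by (simp add: theta_def)

lemma theta_minus: "theta \<tau> (- z) = - theta \<tau> z"
  by (simp add: theta_def theta_cofactor_def algebra_simps)

lemma theta_plus_1: "theta \<tau> (z + 1) = - theta \<tau> z"
proof -
  have "nome (- (z + 1) / 2) = - nome (- z / 2)" "nome ((z + 1) / 2) = - nome (z / 2)"
    using nome_diff[of "- z / 2" "1 / 2"] nome_add[of "z / 2" "1 / 2"]
    by (simp_all add: diff_divide_distrib add_divide_distrib)
  moreover have "nome (\<tau> + (z + 1)) = nome (\<tau> + z)" "nome (\<tau> - (z + 1)) = nome (\<tau> - z)"
    by (simp_all add: nome_add nome_diff)
  ultimately show ?thesis by (simp add: theta_def theta_cofactor_def algebra_simps)
qed

text \<open>The shift removes the factor \<open>1 - nome (\<tau> + z)\<close> from one product and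
  adds \<open>1 - nome (- z)\<close> to the other; with the prefactor only a monomial is left
  over.\<close>

lemma theta_plus_tau:
  assumes "Im \<tau> > 0"
  shows "theta \<tau> (z + \<tau>) = - nome (- z - \<tau> / 2) * theta \<tau> z"
proof -
  have n: "norm (nome \<tau>) < 1" using assms by simp
  have a: "qpochhammer_inf (nome (\<tau> + z)) (nome \<tau>)
      = (1 - nome (\<tau> + z)) * qpochhammer_inf (nome (\<tau> + (z + \<tau>))) (nome \<tau>)"
    using qpochhammer_shift[OF n, of "nome (\<tau> + z)"] by (simp only: nome_add mult_ac)
  have b: "qpochhammer_inf (nome (\<tau> - (z + \<tau>))) (nome \<tau>)
      = (1 - nome (- z)) * qpochhammer_inf (nome (\<tau> - z)) (nome \<tau>)"
    using qpochhammer_shift[OF n, of "nome (- z)"] by (simp add: nome_diff nome_minus)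
  \<comment> \<open>The prefactor of \<open>theta\<close> has half arguments, so everything is
    written in the square roots \<open>nome (z / 2)\<close> and
    \<open>nome (\<tau> / 2)\<close>.\<close>
  have c: "nome \<tau> = nome (\<tau> / 2) ^ 2" "nome z = nome (z / 2) ^ 2"
    by (simp_all add: nome_power)
  have d: "nome (- (z + \<tau>) / 2) = 1 / (nome (z / 2) * nome (\<tau> / 2))"
    "nome ((z + \<tau>) / 2) = nome (z / 2) * nome (\<tau> / 2)"
    "nome (- z / 2) = 1 / nome (z / 2)"
    "nome (- z - \<tau> / 2) = 1 / (nome (z / 2) ^ 2 * nome (\<tau> / 2))"
    "nome (- z) = 1 / nome (z / 2) ^ 2" "nome (\<tau> + z) = nome (\<tau> / 2) ^ 2 * nome (z / 2) ^ 2"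
    by (simp_all add: nome_add [symmetric] nome_minus [symmetric] c [symmetric] add_divide_distrib
        diff_divide_distrib flip: nome_diff)
  show ?thesis
    unfolding theta_def theta_cofactor_def a b unfolding d by (simp add: field_simps power2_eq_square)
qed

lemma theta_cofactor_nonzero:
  assumes "Im \<tau> > 0" "z \<in> period_parallelogram \<tau> 1"
  shows "theta_cofactor \<tau> z \<noteq> 0"
proof -
  have "\<bar>Im z\<bar> < Im \<tau>"
    using assms by (simp add: period_parallelogram_def abs_divide)
  then have "Im (\<tau> + z) > 0" "Im (\<tau> - z) > 0"
    by (auto simp: abs_less_iff)
  then show ?thesis
    using assms unfolding theta_cofactor_def by (simp add: qpochhammer_nonzero)
qed

lemma theta_eq_0_iff:
  assumes "Im \<tau> > 0" "z \<in> period_parallelogram \<tau> 1"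
  shows "theta \<tau> z = 0 \<longleftrightarrow> z = 0"
proof
  assume "theta \<tau> z = 0"
  then have "nome (- (z / 2)) = nome (z / 2)"
    using theta_cofactor_nonzero[OF assms] by (simp add: theta_def)
  then have "nome (z / 2) * nome (z / 2) = 1"
    by (simp add: nome_minus field_simps)
  then have "nome z = 1" by (simp flip: nome_add)
  then obtain n where n: "z = of_int n" by (auto simp: nome_eq_1_iff elim: Ints_cases)
  then have "n = 0" using assms by (simp add: period_parallelogram_def)
  then show "z = 0" using n by simp
qed simp

text \<open>The derivative of the prefactor of \<open>theta\<close> at 0, needed for
  \<open>c = \<tau>\<close> and \<open>c = 1\<close>; the quotient of the two limits is the 1/\<tau>
  in the inversion constant.\<close>

lemma theta_derivative_aux:
  "((\<lambda>z. (nome (- (z / c) / 2) - nome (z / c / 2)) / z) \<longlongrightarrow> - 2 * of_real pi * \<i> / c) (at 0)"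
  if "c \<noteq> 0"
proof -
  have "((\<lambda>z. nome (- (z / c) / 2) - nome (z / c / 2)) has_field_derivative - 2 * of_real pi * \<i> / c) (at 0)"
    unfolding nome_def using that by (auto intro!: derivative_eq_intros simp: field_simps)
  then show ?thesis by (simp add: DERIV_def)
qed

text \<open>The two theta functions have the same zeros, and the Gaussian factor makes their
  quasi-periods agree, so the quotient is an elliptic function without poles.\<close>

lemma gaussian_theta_inversion:
  assumes \<tau>: "Im \<tau> > 0" and nz: "theta \<tau> z \<noteq> 0"
  defines "C \<equiv> qpochhammer_inf (nome (- 1 / \<tau>)) (nome (- 1 / \<tau>)) ^ 2
              / (\<tau> * qpochhammer_inf (nome \<tau>) (nome \<tau>) ^ 2)"
  shows "nome (- z\<^sup>2 / (2 * \<tau>)) * theta (- 1 / \<tau>) (z / \<tau>) = C * theta \<tau> z"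
proof -
  define \<sigma> where "\<sigma> = - 1 / \<tau>"
  have \<tau>0: "\<tau> \<noteq> 0" using \<tau> by auto
  have \<sigma>: "Im \<sigma> > 0"
    using \<tau> by (simp add: \<sigma>_def Im_divide power2_eq_square add_nonneg_pos)
  define J where "J = (\<lambda>z. nome (- z\<^sup>2 / (2 * \<tau>)) * theta \<sigma> (z / \<tau>))"
  have J1: "J (z + 1) = - J z" for z
  proof -
    have "theta \<sigma> (z / \<tau>) = theta \<sigma> ((z + 1) / \<tau> + \<sigma>)"
      by (simp add: \<sigma>_def add_divide_distrib)
    also have "\<dots> = - nome (- ((z + 1) / \<tau>) - \<sigma> / 2) * theta \<sigma> ((z + 1) / \<tau>)"
      by (rule theta_plus_tau[OF \<sigma>])
    finally have *: "J z = - (nome (- z\<^sup>2 / (2 * \<tau>)) * nome (- ((z + 1) / \<tau>) - \<sigma> / 2)) * theta \<sigma> ((z + 1) / \<tau>)"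
      by (simp add: J_def)
    \<comment> \<open>Completing the square: the Gaussian absorbs the quasi-period factor of
      \<open>theta \<sigma>\<close>.\<close>
    have "- z\<^sup>2 / (2 * \<tau>) + (- ((z + 1) / \<tau>) - \<sigma> / 2) = - (z + 1)\<^sup>2 / (2 * \<tau>)"
      using \<tau>0 by (simp add: \<sigma>_def field_simps power2_eq_square)
    then show ?thesis using * by (simp only: J_def nome_add [symmetric]) simp
  qed
  have J\<tau>: "J (z + \<tau>) = - nome (- z - \<tau> / 2) * J z" for z
  proof -
    have "(z + \<tau>) / \<tau> = z / \<tau> + 1" using \<tau>0 by (simp add: field_simps)
    then have "J (z + \<tau>) = - (nome (- (z + \<tau>)\<^sup>2 / (2 * \<tau>)) * theta \<sigma> (z / \<tau>))"
      by (simp add: J_def theta_plus_1)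
    moreover have "- (z + \<tau>)\<^sup>2 / (2 * \<tau>) = (- z - \<tau> / 2) + - z\<^sup>2 / (2 * \<tau>)"
      using \<tau>0 by (simp add: field_simps power2_eq_square)
    ultimately show ?thesis by (simp only: J_def nome_add) simp
  qed
  \<comment> \<open>\<open>C\<close> is the limit of the quotient at 0. Using it at every zero of
    \<open>theta \<tau>\<close> keeps \<open>g\<close> doubly periodic.\<close>
  define g where "g = (\<lambda>z. if theta \<tau> z = 0 then C else J z / theta \<tau> z)"
  have g1: "g (z + 1) = g z" and g\<tau>: "g (z + \<tau>) = g z" for z
    by (simp_all add: g_def J1 J\<tau> theta_plus_1 theta_plus_tau[OF \<tau>])
  have J_hol: "J holomorphic_on UNIV"
  proof -
    have "(theta \<sigma> \<circ> (\<lambda>z. z / \<tau>)) holomorphic_on UNIV"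
      using \<tau>0 by (intro holomorphic_on_compose_gen[OF _ theta_holomorphic[OF \<sigma>]] holomorphic_intros) auto
    then show ?thesis
      unfolding J_def using \<tau>0 by (intro holomorphic_intros) (auto simp: o_def)
  qed
  have lim: "(g \<longlongrightarrow> g 0) (at 0)"
  proof (rule Lim_transform_eventually)
    have cont: "isCont (theta_cofactor \<tau>') z" if "Im \<tau>' > 0" for \<tau>' z
      using holomorphic_on_imp_continuous_on[OF theta_cofactor_holomorphic[OF that]]
      by (simp add: continuous_on_eq_continuous_at)
    have tc: "theta_cofactor \<tau>' 0 = qpochhammer_inf (nome \<tau>') (nome \<tau>') ^ 2" for \<tau>'
      by (simp add: theta_cofactor_def power2_eq_square)
    have 1: "((\<lambda>z. theta_cofactor \<sigma> (z / \<tau>)) \<longlongrightarrow> theta_cofactor \<sigma> 0) (at 0)"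
      using \<tau>0 by (intro isCont_tendsto_compose[OF cont[OF \<sigma>]]) (auto intro!: tendsto_eq_intros)
    have 2: "(theta_cofactor \<tau> \<longlongrightarrow> theta_cofactor \<tau> 0) (at 0)"
      using cont[OF \<tau>] by (simp add: isCont_def)
    have 3: "((\<lambda>z. nome (- z\<^sup>2 / (2 * \<tau>))) \<longlongrightarrow> 1) (at 0)"
      unfolding nome_def using \<tau>0 by (auto intro!: tendsto_eq_intros)
    have nz: "theta_cofactor \<tau> 0 \<noteq> 0"
      using theta_cofactor_nonzero[OF \<tau>] by (simp add: period_parallelogram_def)
    \<comment> \<open>Numerator and denominator are both divided by \<open>z\<close>, which turns
      the two vanishing prefactors into difference quotients.\<close>
    have "((\<lambda>z. nome (- z\<^sup>2 / (2 * \<tau>)) * ((nome (- (z / \<tau>) / 2) - nome (z / \<tau> / 2)) / z * theta_cofactor \<sigma> (z / \<tau>))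
        / ((nome (- (z / 1) / 2) - nome (z / 1 / 2)) / z * theta_cofactor \<tau> z))
      \<longlongrightarrow> 1 * (- 2 * of_real pi * \<i> / \<tau> * theta_cofactor \<sigma> 0) / (- 2 * of_real pi * \<i> / 1 * theta_cofactor \<tau> 0)) (at 0)"
      using nz by (intro tendsto_intros 1 2 3 theta_derivative_aux) (use \<tau>0 in auto)
    also have "1 * (- 2 * of_real pi * \<i> / \<tau> * theta_cofactor \<sigma> 0) / (- 2 * of_real pi * \<i> / 1 * theta_cofactor \<tau> 0) = g 0"
      using \<tau>0 nz by (simp add: g_def C_def tc \<sigma>_def field_simps)
    finally show "((\<lambda>z. nome (- z\<^sup>2 / (2 * \<tau>)) * ((nome (- (z / \<tau>) / 2) - nome (z / \<tau> / 2)) / z * theta_cofactor \<sigma> (z / \<tau>))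
        / ((nome (- (z / 1) / 2) - nome (z / 1 / 2)) / z * theta_cofactor \<tau> z)) \<longlongrightarrow> g 0) (at 0)" .
    have "eventually (\<lambda>z. z \<in> period_parallelogram \<tau> 1 - {0}) (at 0)"
      by (intro eventually_at_in_open open_period_parallelogram) (simp add: period_parallelogram_def)
    then show "eventually (\<lambda>z. nome (- z\<^sup>2 / (2 * \<tau>)) * ((nome (- (z / \<tau>) / 2) - nome (z / \<tau> / 2)) / z * theta_cofactor \<sigma> (z / \<tau>))
        / ((nome (- (z / 1) / 2) - nome (z / 1 / 2)) / z * theta_cofactor \<tau> z) = g z) (at 0)"
    proof eventually_elim
      case (elim z)
      then have "theta \<tau> z \<noteq> 0" using theta_eq_0_iff[OF \<tau>] by auto
      then show ?case using elim by (simp add: g_def J_def theta_def)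
    qed
  qed
  have hol: "g holomorphic_on period_parallelogram \<tau> 1 - {0}"
  proof -
    have "(\<lambda>z. J z / theta \<tau> z) holomorphic_on period_parallelogram \<tau> 1 - {0}"
      by (intro holomorphic_on_divide holomorphic_on_subset[OF J_hol]
          holomorphic_on_subset[OF theta_holomorphic[OF \<tau>]]) (use theta_eq_0_iff[OF \<tau>] in auto)
    then show ?thesis
      by (rule holomorphic_transform) (use theta_eq_0_iff[OF \<tau>] in \<open>simp add: g_def\<close>)
  qed
  \<comment> \<open>The origin is the only zero of \<open>theta \<tau>\<close> in the parallelogram,
    and the limit just found makes it removable.\<close>
  have "g holomorphic_on period_parallelogram \<tau> 1"
  proof (rule no_isolated_singularity'[OF _ hol open_period_parallelogram])
    show "(g \<longlongrightarrow> g z) (at z within period_parallelogram \<tau> 1)" if "z \<in> {0}" for z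
      using tendsto_within_subset[OF lim subset_UNIV] that by (simp only: singleton_iff)
  qed simp
  from elliptic_holomorphic_imp_constant[OF \<tau> this g1 g\<tau>]
  obtain c where c: "\<forall>z. g z = c" by (elim exE)
  have "c = C" using c[rule_format, of 0] by (simp add: g_def)
  have "J z = C * theta \<tau> z"
    using c[rule_format, of z] \<open>c = C\<close> nz by (simp add: g_def field_simps)
  then show ?thesis by (simp add: J_def \<sigma>_def)
qed

text \<open>At a half period the two Pochhammer products merge into one square, and the product of
  the three squares collapses by Euler's identity. Having an explicit value for \<tau> and for
  -1/\<tau> alike determines the cube of the inversion constant.\<close>

lemma theta_half_periods:
  assumes \<tau>: "Im \<tau> > 0"
  shows "theta \<tau> (1 / 2) * theta \<tau> (\<tau> / 2) * theta \<tau> ((1 + \<tau>) / 2) = - 2 * nome (- \<tau> / 2)"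
proof -
  define q where "q = nome \<tau>"
  define h where "h = nome (\<tau> / 2)"
  define k where "k = nome (\<tau> / 4)"
  have q: "norm q < 1" using \<tau> by (simp add: q_def)
  have hq: "h\<^sup>2 = q" and kh: "k\<^sup>2 = h" and [simp]: "k \<noteq> 0" "h \<noteq> 0"
    by (simp_all add: q_def h_def k_def nome_power)
  have 1: "theta \<tau> (1 / 2) = - 2 * \<i> * qpochhammer_inf (- q) q ^ 2"
    by (simp add: theta_def theta_cofactor_def nome_add nome_diff nome_minus nome_quarter q_def
        power2_eq_square)
  have 2: "theta \<tau> (\<tau> / 2) = qpochhammer_inf h q ^ 2 / k"
  proof -
    have "nome (\<tau> + \<tau> / 2) = h * q" "nome (\<tau> - \<tau> / 2) = h" "nome (\<tau> / 2 / 2) = k" "nome (- (\<tau> / 2) / 2) = 1 / k"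
      using nome_add[of "\<tau> / 2" \<tau>] by (simp_all add: h_def k_def q_def add_ac flip: nome_minus)
    then have "theta \<tau> (\<tau> / 2) = (1 / k - k) * (qpochhammer_inf (h * q) q * qpochhammer_inf h q)"
      unfolding theta_def theta_cofactor_def q_def [symmetric] by (simp only:)
    also have "\<dots> = ((1 - h) * qpochhammer_inf (h * q) q) * qpochhammer_inf h q / k"
      unfolding kh [symmetric] by (simp add: field_simps power2_eq_square)
    finally show ?thesis
      unfolding qpochhammer_shift[OF q, of h, symmetric] by (simp add: power2_eq_square)
  qed
  have 3: "theta \<tau> ((1 + \<tau>) / 2) = - \<i> * qpochhammer_inf (- h) q ^ 2 / k"
  proof -
    have "nome (\<tau> + (1 + \<tau>) / 2) = - h * q" "nome (\<tau> - (1 + \<tau>) / 2) = - h"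
      "nome ((1 + \<tau>) / 2 / 2) = \<i> * k" "nome (- ((1 + \<tau>) / 2) / 2) = - \<i> / k"
    proof -
      have "\<tau> + (1 + \<tau>) / 2 = \<tau> + 1 / 2 + \<tau> / 2" "\<tau> - (1 + \<tau>) / 2 = \<tau> / 2 - 1 / 2"
        "(1 + \<tau>) / 2 / 2 = 1 / 4 + \<tau> / 4" "- ((1 + \<tau>) / 2) / 2 = - (1 / 4 + \<tau> / 4)"
        by (simp_all add: field_simps)
      then show "nome (\<tau> + (1 + \<tau>) / 2) = - h * q" "nome (\<tau> - (1 + \<tau>) / 2) = - h"
        "nome ((1 + \<tau>) / 2 / 2) = \<i> * k" "nome (- ((1 + \<tau>) / 2) / 2) = - \<i> / k"
        by (simp_all only: nome_add nome_diff nome_minus nome_half nome_quarter h_def k_def q_def)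
          (simp_all add: field_simps)
    qed
    then have "theta \<tau> ((1 + \<tau>) / 2) = (- \<i> / k - \<i> * k) * (qpochhammer_inf (- h * q) q * qpochhammer_inf (- h) q)"
      unfolding theta_def theta_cofactor_def q_def [symmetric] by (simp only:)
    also have "\<dots> = - \<i> * ((1 - - h) * qpochhammer_inf (- h * q) q) * qpochhammer_inf (- h) q / k"
      unfolding kh [symmetric] by (simp add: field_simps power2_eq_square)
    finally show ?thesis
      unfolding qpochhammer_shift[OF q, of "- h", symmetric] by (simp add: power2_eq_square)
  qed
  \<comment> \<open>As \<open>h\<close> is a square root of \<open>q\<close>, the two inner products
    multiply to \<open>(q; q^2)\<close>, the partner of \<open>(-q; q)\<close> in Euler's
    identity.\<close>
  have "qpochhammer_inf (- q) q * (qpochhammer_inf h q * qpochhammer_inf (- h) q) = 1"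
    using qpochhammer_mult_uminus[OF q, of h] qpochhammer_euler[OF q] hq by simp
  then have "(qpochhammer_inf (- q) q * (qpochhammer_inf h q * qpochhammer_inf (- h) q))\<^sup>2 = 1"
    by simp
  moreover have "theta \<tau> (1 / 2) * theta \<tau> (\<tau> / 2) * theta \<tau> ((1 + \<tau>) / 2)
     = - 2 / h * (qpochhammer_inf (- q) q * (qpochhammer_inf h q * qpochhammer_inf (- h) q))\<^sup>2"
    unfolding 1 2 3 kh [symmetric] by (simp add: power_mult_distrib field_simps power2_eq_square)
  ultimately show ?thesis by (simp add: h_def nome_minus)
qed

text \<open>The square of the Dedekind eta function. It has weight 1, so its inversion formula
  contains no square root of \<tau>.\<close>

definition eta_sq :: "complex \<Rightarrow> complex" where
  "eta_sq \<tau> = nome (\<tau> / 12) * qpochhammer_inf (nome \<tau>) (nome \<tau>) ^ 2"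

lemma eta_sq_nonzero: "Im \<tau> > 0 \<Longrightarrow> eta_sq \<tau> \<noteq> 0"
  by (simp add: eta_sq_def qpochhammer_nonzero)

lemma open_upper_half_plane: "open {\<tau>. Im \<tau> > 0}"
  by (simp add: open_halfspace_Im_gt)

lemma connected_upper_half_plane: "connected {\<tau>. Im \<tau> > 0}"
  by (simp add: convex_connected convex_halfspace_Im_gt)

lemma eta_sq_holomorphic: "eta_sq holomorphic_on {\<tau>. Im \<tau> > 0}"
  unfolding eta_sq_def
  by (intro holomorphic_intros qpochhammer_holomorphic open_upper_half_plane) auto

lemma Im_minus_inverse: "Im \<tau> > 0 \<Longrightarrow> Im (- 1 / \<tau>) > 0"
  by (simp add: Im_divide power2_eq_square add_nonneg_pos)

text \<open>The theta inversion is multiplied over the three half periods. Division by \<tau>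
  exchanges the first two and fixes the third, up to sign and lattice translation, so both sides
  contain the explicit product and only the cube of the constant survives.\<close>

lemma eta_sq_inversion_cube:
  assumes \<tau>: "Im \<tau> > 0"
  shows "(eta_sq (- 1 / \<tau>) / (\<tau> * eta_sq \<tau>)) ^ 3 = \<i>"
proof -
  define \<sigma> where "\<sigma> = - 1 / \<tau>"
  define C where "C = qpochhammer_inf (nome \<sigma>) (nome \<sigma>) ^ 2
              / (\<tau> * qpochhammer_inf (nome \<tau>) (nome \<tau>) ^ 2)"
  have \<tau>0: "\<tau> \<noteq> 0" using \<tau> by auto
  have \<sigma>: "Im \<sigma> > 0" unfolding \<sigma>_def by (rule Im_minus_inverse[OF \<tau>])
  have nz: "theta \<tau> (1 / 2) * theta \<tau> (\<tau> / 2) * theta \<tau> ((1 + \<tau>) / 2) \<noteq> 0"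
    unfolding theta_half_periods[OF \<tau>] by simp
  then have nz1: "theta \<tau> (1 / 2) \<noteq> 0" and nz2: "theta \<tau> (\<tau> / 2) \<noteq> 0"
    and nz3: "theta \<tau> ((1 + \<tau>) / 2) \<noteq> 0" by auto
  have inv: "nome (- z\<^sup>2 / (2 * \<tau>)) * theta \<sigma> (z / \<tau>) = C * theta \<tau> z" if "theta \<tau> z \<noteq> 0" for z
    using gaussian_theta_inversion[OF \<tau> that] by (simp add: C_def \<sigma>_def)
  have "1 / 2 / \<tau> = - (\<sigma> / 2)" by (simp add: \<sigma>_def)
  then have 1: "nome (- (1 / 2)\<^sup>2 / (2 * \<tau>)) * (- theta \<sigma> (\<sigma> / 2)) = C * theta \<tau> (1 / 2)"
    using inv[OF nz1] by (simp add: theta_minus)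
  have 2: "nome (- (\<tau> / 2)\<^sup>2 / (2 * \<tau>)) * theta \<sigma> (1 / 2) = C * theta \<tau> (\<tau> / 2)"
    using inv[OF nz2] \<tau>0 by simp
  have "(1 + \<tau>) / 2 / \<tau> = - ((1 + \<sigma>) / 2) + 1" using \<tau>0 by (simp add: \<sigma>_def field_simps)
  then have eq: "theta \<sigma> ((1 + \<tau>) / 2 / \<tau>) = theta \<sigma> ((1 + \<sigma>) / 2)"
    by (simp only: theta_minus theta_plus_1 minus_minus)
  have 3: "nome (- ((1 + \<tau>) / 2)\<^sup>2 / (2 * \<tau>)) * theta \<sigma> ((1 + \<sigma>) / 2) = C * theta \<tau> ((1 + \<tau>) / 2)"
    using inv[OF nz3] unfolding eq .
  have rearrange: "(n1 * (- t2)) * (n2 * t1) * (n3 * t3) = - (n1 * n2 * n3) * (t1 * t2 * t3)"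
    for n1 n2 n3 t1 t2 t3 :: complex
    by (simp add: mult_ac)
  have cancel: "c * x = - (y * z)" if "c * (- 2 * x) = - y * (- 2 * z)" for c x y z :: complex
  proof -
    have "(- 2) * (c * x) = (- 2) * (- (y * z))" using that by (simp add: mult_ac)
    then show ?thesis unfolding mult_cancel_left by simp
  qed
  have "C ^ 3 * (a * b * c) = (C * a) * (C * b) * (C * c)" for a b c
    by (simp only: power3_eq_cube mult_ac)
  from this[of "theta \<tau> (1 / 2)" "theta \<tau> (\<tau> / 2)" "theta \<tau> ((1 + \<tau>) / 2)"]
  have "C ^ 3 * (- 2 * nome (- \<tau> / 2))
     = (C * theta \<tau> (1 / 2)) * (C * theta \<tau> (\<tau> / 2)) * (C * theta \<tau> ((1 + \<tau>) / 2))"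
    unfolding theta_half_periods[OF \<tau>] .
  also have "\<dots> = - (nome (- (1 / 2)\<^sup>2 / (2 * \<tau>)) * nome (- (\<tau> / 2)\<^sup>2 / (2 * \<tau>)) * nome (- ((1 + \<tau>) / 2)\<^sup>2 / (2 * \<tau>)))
     * (theta \<sigma> (1 / 2) * theta \<sigma> (\<sigma> / 2) * theta \<sigma> ((1 + \<sigma>) / 2))"
    unfolding 1 [symmetric] 2 [symmetric] 3 [symmetric] by (rule rearrange)
  \<comment> \<open>The cross term of the third square contributes the summand -1/4, from which the
    factor \<open>\<i>\<close> arises.\<close>
  also have "nome (- (1 / 2)\<^sup>2 / (2 * \<tau>)) * nome (- (\<tau> / 2)\<^sup>2 / (2 * \<tau>)) * nome (- ((1 + \<tau>) / 2)\<^sup>2 / (2 * \<tau>))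
     = nome (- (1 / 4) + (\<sigma> / 4 - \<tau> / 4))"
    unfolding nome_add [symmetric] \<sigma>_def using \<tau>0
    by (intro arg_cong[where f = nome]) (simp add: field_simps power2_eq_square)
  also have "theta \<sigma> (1 / 2) * theta \<sigma> (\<sigma> / 2) * theta \<sigma> ((1 + \<sigma>) / 2) = - 2 * nome (- \<sigma> / 2)"
    by (rule theta_half_periods[OF \<sigma>])
  finally have "C ^ 3 * nome (- \<tau> / 2) = - (nome (- (1 / 4) + (\<sigma> / 4 - \<tau> / 4)) * nome (- \<sigma> / 2))"
    by (rule cancel)
  then have "C ^ 3 = - (nome (- (1 / 4) + (\<sigma> / 4 - \<tau> / 4)) * nome (- \<sigma> / 2) * nome (\<tau> / 2))"
    by (simp add: nome_minus field_simps)
  also have "\<dots> = - nome (- (1 / 4) + (- \<sigma> / 4 + \<tau> / 4))"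
    unfolding nome_add [symmetric] by (intro arg_cong[where f = "\<lambda>x. - nome x"]) (simp add: field_simps)
  also have "\<dots> = \<i> * nome (- \<sigma> / 4 + \<tau> / 4)"
    by (simp only: nome_add nome_minus nome_quarter) (simp add: field_simps)
  finally have C3: "C ^ 3 = \<i> * nome (- \<sigma> / 4 + \<tau> / 4)" .
  have "(eta_sq \<sigma> / (\<tau> * eta_sq \<tau>)) = nome (\<sigma> / 12 - \<tau> / 12) * C"
    by (simp add: eta_sq_def C_def nome_diff)
  then have "(eta_sq \<sigma> / (\<tau> * eta_sq \<tau>)) ^ 3 = nome (3 * (\<sigma> / 12 - \<tau> / 12)) * C ^ 3"
    by (simp add: power_mult_distrib nome_power)
  also have "\<dots> = \<i> * nome (3 * (\<sigma> / 12 - \<tau> / 12) + (- \<sigma> / 4 + \<tau> / 4))"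
    unfolding C3 nome_add by (simp add: mult_ac)
  also have "3 * (\<sigma> / 12 - \<tau> / 12) + (- \<sigma> / 4 + \<tau> / 4) = 0"
    by (simp add: field_simps)
  finally show ?thesis by (simp add: \<sigma>_def)
qed

text \<open>The quotient is continuous on a connected set and takes values among the three cube
  roots of \<open>\<i>\<close>, so it is constant; the fixed point \<open>\<i>\<close> of the
  inversion tells which root it is.\<close>

theorem eta_sq_inversion:
  assumes \<tau>: "Im \<tau> > 0"
  shows "eta_sq (- 1 / \<tau>) = - \<i> * \<tau> * eta_sq \<tau>"
proof -
  let ?H = "{\<tau>. Im \<tau> > 0}"
  define r where "r = (\<lambda>\<tau>. eta_sq (- 1 / \<tau>) / (\<tau> * eta_sq \<tau>))"
  have "(eta_sq \<circ> (\<lambda>\<tau>. - 1 / \<tau>)) holomorphic_on ?H"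
    by (intro holomorphic_on_compose_gen[OF _ eta_sq_holomorphic] holomorphic_intros)
      (use Im_minus_inverse in auto)
  then have "r holomorphic_on ?H"
    unfolding r_def using eta_sq_nonzero
    by (intro holomorphic_intros eta_sq_holomorphic) (auto simp: o_def)
  then have cont: "continuous_on ?H r" by (rule holomorphic_on_imp_continuous_on)
  have "r ` ?H \<subseteq> {z. z ^ 3 = \<i>}"
    using eta_sq_inversion_cube by (auto simp: r_def)
  moreover have "finite {z::complex. z ^ 3 = \<i>}"
    by (rule finite_nth_roots) simp
  ultimately have "r constant_on ?H"
    using finite_subset by (intro continuous_finite_range_constant connected_upper_half_plane cont) blast
  then have "r \<tau> = r \<i>"
    using \<tau> by (auto simp: constant_on_def)
  also have "r \<i> = - \<i>"
    using eta_sq_nonzero[of \<i>] by (simp add: r_def)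
  finally have "eta_sq (- 1 / \<tau>) / (\<tau> * eta_sq \<tau>) = - \<i>" by (simp add: r_def)
  moreover have "\<tau> * eta_sq \<tau> \<noteq> 0" using \<tau> eta_sq_nonzero[OF \<tau>] by auto
  ultimately show ?thesis by (simp add: divide_eq_eq)
qed

section \<open>Moebius maps of the upper half plane\<close>

lemma Im_moebius:
  fixes a b c d :: real
  shows "Im ((of_real a * \<tau> + of_real b) / (of_real c * \<tau> + of_real d))
    = (a * d - b * c) * Im \<tau> / ((c * Re \<tau> + d)\<^sup>2 + (c * Im \<tau>)\<^sup>2)"
  by (simp add: Im_divide algebra_simps)

lemma Im_moebius_pos:
  fixes a b c d :: real
  assumes "Im \<tau> > 0" "a * d - b * c > 0"
  shows "Im ((of_real a * \<tau> + of_real b) / (of_real c * \<tau> + of_real d)) > 0"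
proof -
  have "(c * Re \<tau> + d)\<^sup>2 + (c * Im \<tau>)\<^sup>2 > 0"
  proof (cases "c = 0")
    case True
    then have "d \<noteq> 0" using assms by auto
    then show ?thesis using True by simp
  next
    case False
    then have "(c * Im \<tau>)\<^sup>2 > 0" using assms by simp
    then show ?thesis by (simp add: add_nonneg_pos)
  qed
  then show ?thesis unfolding Im_moebius using assms by simp
qed

lemma upper_half_plane_neq_real:
  fixes c d :: real
  assumes "Im \<tau> > 0" "c \<noteq> 0"
  shows "of_real c * \<tau> + of_real d \<noteq> 0"
proof
  assume "of_real c * \<tau> + of_real d = 0"
  then have "Im (of_real c * \<tau> + of_real d) = 0" by simp
  then show False using assms by simp
qed

lemma eta_sq_plus_int: "eta_sq (\<tau> + of_int n) = nome (of_int n / 12) * eta_sq \<tau>"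
  by (simp add: eta_sq_def nome_add add_divide_distrib)

lemma eta_sq_inversion':
  assumes "Im \<tau> > 0" "\<sigma> = - 1 / \<tau>"
  shows "eta_sq \<sigma> = - \<i> * \<tau> * eta_sq \<tau>"
  using eta_sq_inversion[OF assms(1)] assms(2) by simp

subsection \<open>The Hauptmodul of level 13\<close>

definition hauptmodul13 :: "complex \<Rightarrow> complex" where
  "hauptmodul13 \<tau> = eta_sq \<tau> / eta_sq (13 * \<tau>)"

lemma hauptmodul13_nonzero: "Im \<tau> > 0 \<Longrightarrow> hauptmodul13 \<tau> \<noteq> 0"
  by (simp add: hauptmodul13_def eta_sq_nonzero)

text \<open>The multipliers of numerator and denominator agree because 12 divides 13 - 1.\<close>

lemma hauptmodul13_plus_int: "hauptmodul13 (\<tau> + of_int n) = hauptmodul13 \<tau>"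
proof -
  have "eta_sq (13 * (\<tau> + of_int n)) = nome (of_int (13 * n) / 12) * eta_sq (13 * \<tau>)"
    using eta_sq_plus_int[of "13 * \<tau>" "13 * n"] by (simp add: distrib_left)
  also have "of_int (13 * n) / 12 = of_int n / 12 + (of_int n :: complex)"
    by simp
  also have "nome \<dots> = nome (of_int n / 12)"
    unfolding nome_add by simp
  finally show ?thesis by (simp add: hauptmodul13_def eta_sq_plus_int)
qed

lemma hauptmodul13_plus_1: "hauptmodul13 (\<tau> + 1) = hauptmodul13 \<tau>"
  using hauptmodul13_plus_int[of \<tau> 1] by simp

lemma hauptmodul13_minus_1: "hauptmodul13 (\<tau> - 1) = hauptmodul13 \<tau>"
  using hauptmodul13_plus_int[of \<tau> "- 1"] by simp

lemma hauptmodul13_fricke: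
  assumes "Im \<tau> > 0"
  shows "hauptmodul13 (- 1 / (13 * \<tau>)) = 13 / hauptmodul13 \<tau>"
proof -
  have "\<tau> \<noteq> 0" using assms by auto
  have "eta_sq (- 1 / (13 * \<tau>)) = - \<i> * (13 * \<tau>) * eta_sq (13 * \<tau>)"
    using assms by (intro eta_sq_inversion) simp
  moreover have "eta_sq (13 * (- 1 / (13 * \<tau>))) = - \<i> * \<tau> * eta_sq \<tau>"
    using assms by (intro eta_sq_inversion') (simp_all add: field_simps)
  ultimately show ?thesis
    using \<open>\<tau> \<noteq> 0\<close> by (simp add: hauptmodul13_def)
qed

text \<open>The matrix has determinant 1 and trace 1. It is written as a word in inversions and
  translations: the image is \<open>-1/w1\<close> with \<open>w1 = 3 - 1/w2\<close> and
  \<open>w2 = -4 - 1/\<tau>\<close>, while 13 times the image is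
  \<open>-4 - 1/(13 \<tau> + 3)\<close>. The same roots of unity and the same automorphy factor
  appear in both and cancel.\<close>

lemma hauptmodul13_order3:
  assumes "Im \<tau> > 0"
  shows "hauptmodul13 ((4 * \<tau> + 1) / (- 13 * \<tau> - 3)) = hauptmodul13 \<tau>"
proof -
  define w1 where "w1 = (13 * \<tau> + 3) / (4 * \<tau> + 1)"
  define w2 where "w2 = - ((4 * \<tau> + 1) / \<tau>)"
  have nz: "\<tau> \<noteq> 0" "4 * \<tau> + 1 \<noteq> 0" "13 * \<tau> + 3 \<noteq> 0" "- 13 * \<tau> - 3 \<noteq> 0"
    using upper_half_plane_neq_real[OF assms, of 4 1] upper_half_plane_neq_real[OF assms, of 13 3]
      upper_half_plane_neq_real[OF assms, of "- 13" "- 3"] assms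
    by auto
  have "w2 = (- 4 * \<tau> - 1) / \<tau>" using nz by (simp add: w2_def field_simps)
  then have w1: "Im w1 > 0" and w2: "Im w2 > 0"
    using Im_moebius_pos[OF assms, of 13 1 3 4] Im_moebius_pos[OF assms, of "-4" 0 "-1" 1]
    by (simp_all add: w1_def)
  have "- 1 / w2 = \<tau> / (4 * \<tau> + 1)" by (simp add: w2_def)
  then have e1: "w1 = - 1 / w2 + of_int 3" and e2: "w2 = - 1 / \<tau> + of_int (- 4)"
    using nz by (simp_all add: w1_def w2_def field_simps)
  have "eta_sq ((4 * \<tau> + 1) / (- 13 * \<tau> - 3)) = - \<i> * w1 * eta_sq w1"
    using nz by (intro eta_sq_inversion' w1) (simp add: w1_def field_simps)
  also have "eta_sq w1 = nome (of_int 3 / 12) * (- \<i> * w2 * eta_sq w2)"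
    unfolding e1 eta_sq_plus_int eta_sq_inversion[OF w2] ..
  also have "eta_sq w2 = nome (of_int (- 4) / 12) * (- \<i> * \<tau> * eta_sq \<tau>)"
    unfolding e2 eta_sq_plus_int eta_sq_inversion[OF assms] ..
  finally have "eta_sq ((4 * \<tau> + 1) / (- 13 * \<tau> - 3))
     = \<i> * (w1 * w2 * \<tau>) * nome (of_int 3 / 12) * nome (of_int (- 4) / 12) * eta_sq \<tau>"
    by (simp add: mult_ac)
  also have "w1 * w2 * \<tau> = - (13 * \<tau> + 3)"
    using nz by (simp add: w1_def w2_def)
  finally have num: "eta_sq ((4 * \<tau> + 1) / (- 13 * \<tau> - 3))
     = - (\<i> * (13 * \<tau> + 3) * nome (of_int 3 / 12) * nome (of_int (- 4) / 12)) * eta_sq \<tau>"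
    by (simp add: algebra_simps)
  have "13 * ((4 * \<tau> + 1) / (- 13 * \<tau> - 3)) = - 1 / (13 * \<tau> + of_int 3) + of_int (- 4)"
    using nz by (simp add: divide_simps) (simp add: algebra_simps)
  then have "eta_sq (13 * ((4 * \<tau> + 1) / (- 13 * \<tau> - 3)))
     = nome (of_int (- 4) / 12) * (- \<i> * (13 * \<tau> + of_int 3) * (nome (of_int 3 / 12) * eta_sq (13 * \<tau>)))"
    using eta_sq_inversion[of "13 * \<tau> + of_int 3"] assms by (simp only: eta_sq_plus_int) simp
  then have den: "eta_sq (13 * ((4 * \<tau> + 1) / (- 13 * \<tau> - 3)))
     = - (\<i> * (13 * \<tau> + 3) * nome (of_int 3 / 12) * nome (of_int (- 4) / 12)) * eta_sq (13 * \<tau>)"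
    by simp
  show ?thesis
    unfolding hauptmodul13_def num den using nz by simp
qed

text \<open>As for the element of order 3, with the words \<open>-1/w1\<close>,
  \<open>w1 = -2 - 1/w2\<close>, \<open>w2 = -7 - 1/\<tau>\<close> and
  \<open>7 - 1/(13 \<tau> + 2)\<close>. The roots of unity now differ, being \<open>\<i>\<close> and
  \<open>-\<i>\<close>, but with the different numbers of inversions both automorphy factors become
  \<open>-(13 \<tau> + 2)\<close>.\<close>

lemma hauptmodul13_trace9:
  assumes "Im \<tau> > 0"
  shows "hauptmodul13 ((7 * \<tau> + 1) / (13 * \<tau> + 2)) = hauptmodul13 \<tau>"
proof -
  define w1 where "w1 = (- 13 * \<tau> - 2) / (7 * \<tau> + 1)"
  define w2 where "w2 = - ((7 * \<tau> + 1) / \<tau>)"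
  have nz: "\<tau> \<noteq> 0" "7 * \<tau> + 1 \<noteq> 0" "13 * \<tau> + 2 \<noteq> 0" "- 13 * \<tau> - 2 \<noteq> 0"
    using upper_half_plane_neq_real[OF assms, of 7 1] upper_half_plane_neq_real[OF assms, of 13 2]
      upper_half_plane_neq_real[OF assms, of "- 13" "- 2"] assms
    by auto
  have "w2 = (- 7 * \<tau> - 1) / \<tau>" using nz by (simp add: w2_def field_simps)
  then have w1: "Im w1 > 0" and w2: "Im w2 > 0"
    using Im_moebius_pos[OF assms, of "- 13" 1 "- 2" 7] Im_moebius_pos[OF assms, of "-7" 0 "-1" 1]
    by (simp_all add: w1_def)
  have "- 1 / w2 = \<tau> / (7 * \<tau> + 1)" by (simp add: w2_def)
  then have e1: "w1 = - 1 / w2 + of_int (- 2)" and e2: "w2 = - 1 / \<tau> + of_int (- 7)"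
    using nz by (simp_all add: w1_def w2_def field_simps)
  have n: "nome (of_int (- 2) / 12) * nome (of_int (- 7) / 12) = \<i>"
    "nome (of_int 7 / 12) * nome (of_int 2 / 12) = - \<i>"
  proof -
    have "of_int (- 2) / 12 + of_int (- 7) / 12 = 1 / 4 + (of_int (- 1) :: complex)"
      "of_int 7 / 12 + of_int 2 / 12 = 1 / 2 + 1 / (4 :: complex)" by simp_all
    then show "nome (of_int (- 2) / 12) * nome (of_int (- 7) / 12) = \<i>"
      "nome (of_int 7 / 12) * nome (of_int 2 / 12) = - \<i>"
      unfolding nome_add [symmetric] by (simp_all only: nome_add nome_of_int nome_half nome_quarter) simp_all
  qed
  have "eta_sq ((7 * \<tau> + 1) / (13 * \<tau> + 2)) = - \<i> * w1 * eta_sq w1"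
    using nz by (intro eta_sq_inversion' w1) (simp add: w1_def field_simps)
  also have "eta_sq w1 = nome (of_int (- 2) / 12) * (- \<i> * w2 * eta_sq w2)"
    unfolding e1 eta_sq_plus_int eta_sq_inversion[OF w2] ..
  also have "eta_sq w2 = nome (of_int (- 7) / 12) * (- \<i> * \<tau> * eta_sq \<tau>)"
    unfolding e2 eta_sq_plus_int eta_sq_inversion[OF assms] ..
  finally have "eta_sq ((7 * \<tau> + 1) / (13 * \<tau> + 2))
     = \<i> * (w1 * w2 * \<tau>) * (nome (of_int (- 2) / 12) * nome (of_int (- 7) / 12)) * eta_sq \<tau>"
    by (simp add: mult_ac)
  also have "w1 * w2 * \<tau> = 13 * \<tau> + 2"
    using nz by (simp add: w1_def w2_def)
  finally have num: "eta_sq ((7 * \<tau> + 1) / (13 * \<tau> + 2)) = - (13 * \<tau> + 2) * eta_sq \<tau>"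
    unfolding n by (simp add: algebra_simps)
  have "13 * ((7 * \<tau> + 1) / (13 * \<tau> + 2)) = - 1 / (13 * \<tau> + of_int 2) + of_int 7"
    using nz by (simp add: divide_simps)
  then have "eta_sq (13 * ((7 * \<tau> + 1) / (13 * \<tau> + 2)))
     = nome (of_int 7 / 12) * (- \<i> * (13 * \<tau> + of_int 2) * (nome (of_int 2 / 12) * eta_sq (13 * \<tau>)))"
    using eta_sq_inversion[of "13 * \<tau> + of_int 2"] assms by (simp only: eta_sq_plus_int) simp
  also have "\<dots> = - \<i> * (13 * \<tau> + 2) * (nome (of_int 7 / 12) * nome (of_int 2 / 12)) * eta_sq (13 * \<tau>)"
    by simp
  finally have den: "eta_sq (13 * ((7 * \<tau> + 1) / (13 * \<tau> + 2))) = - (13 * \<tau> + 2) * eta_sq (13 * \<tau>)"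
    unfolding n by (simp add: algebra_simps)
  show ?thesis
    unfolding hauptmodul13_def num den using nz by simp
qed

text \<open>Elements of the coset of the Fricke involution, of determinant 13, whose isometric circles have
  centres \<open>1/2\<close>, \<open>1/3\<close> and \<open>-1/3\<close>.\<close>

definition atkin_lehner2 :: "complex \<Rightarrow> complex" where
  "atkin_lehner2 \<tau> = (13 * \<tau> - 7) / (26 * \<tau> - 13)"

definition atkin_lehner3 :: "complex \<Rightarrow> complex" where
  "atkin_lehner3 \<tau> = (- 13 * \<tau> + 4) / (39 * \<tau> - 13)"

definition atkin_lehner3' :: "complex \<Rightarrow> complex" where
  "atkin_lehner3' \<tau> = (13 * \<tau> + 4) / (39 * \<tau> + 13)"

lemma Im_fricke: "Im \<tau> > 0 \<Longrightarrow> Im (- 1 / (13 * \<tau>)) > 0"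
  using Im_minus_inverse[of "13 * \<tau>"] by simp

lemma Im_atkin_lehner2: "Im \<tau> > 0 \<Longrightarrow> Im (atkin_lehner2 \<tau>) > 0"
  using Im_moebius_pos[of \<tau> 13 "- 13" "- 7" 26] by (simp add: atkin_lehner2_def)

lemma Im_atkin_lehner3': "Im \<tau> > 0 \<Longrightarrow> Im (atkin_lehner3' \<tau>) > 0"
  using Im_moebius_pos[of \<tau> 13 13 4 39] by (simp add: atkin_lehner3'_def)

text \<open>The map is the Fricke involution followed by the element of trace 9.\<close>

lemma hauptmodul13_atkin_lehner2:
  assumes "Im \<tau> > 0"
  shows "hauptmodul13 (atkin_lehner2 \<tau>) = 13 / hauptmodul13 \<tau>"
proof -
  define \<sigma> where "\<sigma> = - 1 / (13 * \<tau>)"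
  have nz: "\<tau> \<noteq> 0" "26 * \<tau> - 13 \<noteq> 0"
    using upper_half_plane_neq_real[OF assms, of 26 "- 13"] assms by auto
  have "13 * \<sigma> + 2 = (26 * \<tau> - 13) / (13 * \<tau>)" "7 * \<sigma> + 1 = (13 * \<tau> - 7) / (13 * \<tau>)"
    using nz(1) by (simp_all add: \<sigma>_def field_simps)
  then have "(7 * \<sigma> + 1) / (13 * \<sigma> + 2) = atkin_lehner2 \<tau>"
    using nz by (simp add: atkin_lehner2_def)
  then show ?thesis
    using hauptmodul13_trace9[of \<sigma>] hauptmodul13_fricke[OF assms] Im_fricke[OF assms]
    by (simp only: \<sigma>_def)
qed

lemma hauptmodul13_atkin_lehner3:
  assumes "Im \<tau> > 0"
  shows "hauptmodul13 (atkin_lehner3 \<tau>) = 13 / hauptmodul13 \<tau>"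
proof -
  define \<sigma> where "\<sigma> = - 1 / (13 * \<tau>)"
  have nz: "\<tau> \<noteq> 0" "39 * \<tau> - 13 \<noteq> 0"
    using upper_half_plane_neq_real[OF assms, of 39 "- 13"] assms by auto
  have "- 13 * \<sigma> - 3 = - ((39 * \<tau> - 13) / (13 * \<tau>))" "4 * \<sigma> + 1 = - ((- 13 * \<tau> + 4) / (13 * \<tau>))"
    using nz(1) by (simp_all add: \<sigma>_def field_simps)
  then have "(4 * \<sigma> + 1) / (- 13 * \<sigma> - 3) = atkin_lehner3 \<tau>"
    using nz by (simp only: minus_divide_divide) (simp add: atkin_lehner3_def)
  then show ?thesis
    using hauptmodul13_order3[of \<sigma>] hauptmodul13_fricke[OF assms] Im_fricke[OF assms]
    by (simp only: \<sigma>_def)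
qed

lemma moebius_compose:
  fixes a b c d a' b' c' d' x :: complex
  assumes "c' * x + d' \<noteq> 0"
  shows "(a * ((a' * x + b') / (c' * x + d')) + b) / (c * ((a' * x + b') / (c' * x + d')) + d)
    = ((a * a' + b * c') * x + (a * b' + b * d')) / ((c * a' + d * c') * x + (c * b' + d * d'))"
proof -
  have "u * ((a' * x + b') / (c' * x + d')) + v
      = ((u * a' + v * c') * x + (u * b' + v * d')) / (c' * x + d')" for u v
    using assms by (simp add: field_simps)
  then show ?thesis using assms by simp
qed

text \<open>\<open>atkin_lehner3'\<close> is the inverse of \<open>atkin_lehner3\<close>.\<close>

lemma hauptmodul13_atkin_lehner3':
  assumes "Im \<tau> > 0"
  shows "hauptmodul13 (atkin_lehner3' \<tau>) = 13 / hauptmodul13 \<tau>"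
proof -
  have nz: "39 * \<tau> + 13 \<noteq> 0"
    using upper_half_plane_neq_real[OF assms, of 39 13] by simp
  have "atkin_lehner3 (atkin_lehner3' \<tau>) = \<tau>"
    using moebius_compose[of 39 \<tau> 13 "- 13" 13 4 4 39 "- 13"] nz
    by (simp add: atkin_lehner3_def atkin_lehner3'_def)
  then have "hauptmodul13 \<tau> = 13 / hauptmodul13 (atkin_lehner3' \<tau>)"
    using hauptmodul13_atkin_lehner3[OF Im_atkin_lehner3'[OF assms]] by simp
  then show ?thesis
    using hauptmodul13_nonzero[OF assms] hauptmodul13_nonzero[OF Im_atkin_lehner3'[OF assms]]
    by (simp add: field_simps)
qed

text \<open>The map is the composition of Fricke, \<open>atkin_lehner3'\<close>, Fricke and a unit
  translation; three of these send the function to 13 over itself, which leaves one such inversion.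
  It is needed because halving the image under \<open>atkin_lehner2\<close> leads to centres 1/4 and
  3/4.\<close>

lemma hauptmodul13_center_quarter:
  assumes "Im \<tau> > 0"
  shows "hauptmodul13 ((39 * \<tau> - 10) / (52 * \<tau> - 13)) = 13 / hauptmodul13 \<tau>"
proof -
  let ?w = "- 1 / (13 * \<tau>)"
  have nz: "\<tau> \<noteq> 0" "- 13 * \<tau> + 3 \<noteq> 0" "39 * \<tau> - 10 \<noteq> 0" "52 * \<tau> - 13 \<noteq> 0"
    using upper_half_plane_neq_real[OF assms, of 39 "- 10"] upper_half_plane_neq_real[OF assms, of 52 "- 13"]
      upper_half_plane_neq_real[OF assms, of "- 13" 3] assms by auto
  define p r where "p = 52 * \<tau> - 13" and "r = 13 * \<tau> - 3"
  have pr: "p \<noteq> 0" "r \<noteq> 0" "p - r = 39 * \<tau> - 10" using nz by (auto simp: p_def r_def)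
  have A: "atkin_lehner3' ?w = p / (13 * r)"
    using moebius_compose[of 13 \<tau> 0 13 0 "- 1" 4 39 13] nz
    by (simp add: atkin_lehner3'_def p_def r_def)
  have "- 1 / (13 * atkin_lehner3' ?w) + 1 = (p - r) / p"
    unfolding A using pr(1,2) by (simp add: field_simps)
  then have "- 1 / (13 * atkin_lehner3' ?w) + 1 = (39 * \<tau> - 10) / (52 * \<tau> - 13)"
    unfolding pr(3) unfolding p_def .
  then have "hauptmodul13 ((39 * \<tau> - 10) / (52 * \<tau> - 13)) = hauptmodul13 (- 1 / (13 * atkin_lehner3' ?w))"
    by (metis hauptmodul13_plus_1)
  also have "\<dots> = 13 / hauptmodul13 (atkin_lehner3' ?w)"
    by (intro hauptmodul13_fricke Im_atkin_lehner3' Im_fricke assms)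
  also have "hauptmodul13 (atkin_lehner3' ?w) = 13 / hauptmodul13 ?w"
    by (intro hauptmodul13_atkin_lehner3' Im_fricke assms)
  finally show ?thesis
    using hauptmodul13_fricke[OF assms] by simp
qed

text \<open>The inverse of the map with centre 1/4.\<close>

lemma hauptmodul13_center_three_quarters:
  assumes "Im \<tau> > 0"
  shows "hauptmodul13 ((13 * \<tau> - 10) / (52 * \<tau> - 39)) = 13 / hauptmodul13 \<tau>"
proof -
  define \<sigma> where "\<sigma> = (13 * \<tau> - 10) / (52 * \<tau> - 39)"
  have nz: "52 * \<tau> - 39 \<noteq> 0"
    using upper_half_plane_neq_real[OF assms, of 52 "- 39"] by simp
  have \<sigma>: "Im \<sigma> > 0"
    using Im_moebius_pos[OF assms, of 13 "- 39" "- 10" 52] by (simp add: \<sigma>_def)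
  have "(39 * \<sigma> - 10) / (52 * \<sigma> - 13) = \<tau>"
    using moebius_compose[of 52 \<tau> "- 39" 39 13 "- 10" "- 10" 52 "- 13"] nz by (simp add: \<sigma>_def)
  then have "hauptmodul13 \<tau> = 13 / hauptmodul13 \<sigma>"
    using hauptmodul13_center_quarter[OF \<sigma>] by simp
  then have "hauptmodul13 \<sigma> = 13 / hauptmodul13 \<tau>"
    using hauptmodul13_nonzero[OF assms] hauptmodul13_nonzero[OF \<sigma>]
    by (simp add: field_simps)
  then show ?thesis by (simp only: \<sigma>_def)
qed

text \<open>Fricke, a unit translation, \<open>atkin_lehner2\<close> and Fricke again. The map
  arises from halving the image under \<open>atkin_lehner3\<close>.\<close>

lemma hauptmodul13_center_sixth:
  assumes "Im \<tau> > 0"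
  shows "hauptmodul13 ((- 13 * \<tau> + 2) / (78 * \<tau> - 13)) = 13 / hauptmodul13 \<tau>"
proof -
  let ?w = "- 1 / (13 * \<tau>)"
  have w: "Im (?w + 1) > 0" using Im_fricke[OF assms] by simp
  have nz: "\<tau> \<noteq> 0" "13 * \<tau> - 2 \<noteq> 0" "6 * \<tau> - 1 \<noteq> 0" "78 * \<tau> - 13 \<noteq> 0"
    using upper_half_plane_neq_real[OF assms, of 13 "- 2"] upper_half_plane_neq_real[OF assms, of 78 "- 13"]
      upper_half_plane_neq_real[OF assms, of 6 "- 1"] assms by auto
  have w_eq: "?w + 1 = (13 * \<tau> + (- 1)) / (13 * \<tau> + 0)"
    using nz by (simp add: field_simps)
  define p r where "p = 78 * \<tau> - 13" and "r = 13 * \<tau> - 2"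
  have pr: "p \<noteq> 0" "r \<noteq> 0" "- r = - 13 * \<tau> + 2" using nz by (auto simp: p_def r_def)
  have A: "atkin_lehner2 (?w + 1) = p / (13 * r)"
    unfolding w_eq
    using moebius_compose[of 13 \<tau> 0 13 13 "- 1" "- 7" 26 "- 13"] nz
    by (simp add: atkin_lehner2_def p_def r_def)
  have "- 1 / (13 * atkin_lehner2 (?w + 1)) = - r / p"
    unfolding A using pr(1,2) by (simp add: field_simps)
  then have "- 1 / (13 * atkin_lehner2 (?w + 1)) = (- 13 * \<tau> + 2) / (78 * \<tau> - 13)"
    by (simp only: pr(3) p_def)
  then have "hauptmodul13 ((- 13 * \<tau> + 2) / (78 * \<tau> - 13)) = hauptmodul13 (- 1 / (13 * atkin_lehner2 (?w + 1)))"
    by simp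
  also have "\<dots> = 13 / hauptmodul13 (atkin_lehner2 (?w + 1))"
    by (intro hauptmodul13_fricke Im_atkin_lehner2 w)
  also have "hauptmodul13 (atkin_lehner2 (?w + 1)) = 13 / hauptmodul13 ?w"
    by (simp only: hauptmodul13_atkin_lehner2[OF w] hauptmodul13_plus_1)
  finally show ?thesis
    using hauptmodul13_fricke[OF assms] by simp
qed

subsection \<open>The modular equation of degree 2\<close>

definition modular_eq2 :: "complex \<Rightarrow> complex \<Rightarrow> complex" where
  "modular_eq2 s u = s\<^sup>2 * u\<^sup>2 + 13 * s * u - u ^ 3 - s ^ 3 + 4 * s * u * (s + u)"

text \<open>This scaling is exactly invariant when \<open>s\<close> and \<open>u\<close> go to
  \<open>13 / s\<close> and \<open>13 / u\<close>: the squared numerator gains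
  \<open>13^6 / (s u)^6\<close>, and the denominator becomes \<open>13^6 / (s u)^3\<close>.\<close>

definition modular_ratio :: "complex \<Rightarrow> complex \<Rightarrow> complex" where
  "modular_ratio s u = modular_eq2 s u ^ 2 / (s * u) ^ 3"

lemma modular_ratio_commute: "modular_ratio s u = modular_ratio u s"
  by (simp add: modular_ratio_def modular_eq2_def algebra_simps)

lemma modular_ratio_fricke:
  assumes "s \<noteq> 0" "u \<noteq> 0"
  shows "modular_ratio (13 / s) (13 / u) = modular_ratio s u"
proof -
  have "modular_eq2 (13 / s) (13 / u) = 13 ^ 3 * modular_eq2 s u / (s * u) ^ 3"
    using assms by (simp add: modular_eq2_def field_simps power2_eq_square power3_eq_cube)
  moreover have "(13 ^ 3 * m / p ^ 3)\<^sup>2 / (169 / p) ^ 3 = m\<^sup>2 / p ^ 3" if "p \<noteq> 0" for m p :: complex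
    using that by (simp add: field_simps power2_eq_square power3_eq_cube)
  ultimately show ?thesis
    using assms by (simp add: modular_ratio_def)
qed

text \<open>The product runs over the three transformations of degree 2. A single factor is not
  invariant, but an element of the group or of the Fricke coset merely permutes the three.\<close>

definition coset_norm :: "complex \<Rightarrow> complex" where
  "coset_norm \<tau> =
     modular_ratio (hauptmodul13 \<tau>) (hauptmodul13 (2 * \<tau>)) *
     modular_ratio (hauptmodul13 \<tau>) (hauptmodul13 (\<tau> / 2)) *
     modular_ratio (hauptmodul13 \<tau>) (hauptmodul13 ((\<tau> + 1) / 2))"

text \<open>Comparing multisets lets each map permute the three transforms in its own way; the
  replacement of every value \<open>h\<close> by \<open>13 / h\<close> is absorbed by
  \<open>modular_ratio\<close>.\<close>

lemma coset_norm_transform: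
  assumes "Im \<tau> > 0"
    and "hauptmodul13 \<sigma> = 13 / hauptmodul13 \<tau>"
    and "mset [hauptmodul13 (2 * \<sigma>), hauptmodul13 (\<sigma> / 2), hauptmodul13 ((\<sigma> + 1) / 2)]
       = mset [13 / hauptmodul13 (2 * \<tau>), 13 / hauptmodul13 (\<tau> / 2), 13 / hauptmodul13 ((\<tau> + 1) / 2)]"
  shows "coset_norm \<sigma> = coset_norm \<tau>"
proof -
  let ?h = hauptmodul13
  have nz: "?h \<tau> \<noteq> 0" "?h (2 * \<tau>) \<noteq> 0" "?h (\<tau> / 2) \<noteq> 0" "?h ((\<tau> + 1) / 2) \<noteq> 0"
    using assms(1) by (simp_all add: hauptmodul13_nonzero)
  have "coset_norm \<sigma> = prod_mset (image_mset (modular_ratio (?h \<sigma>))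
      (mset [?h (2 * \<sigma>), ?h (\<sigma> / 2), ?h ((\<sigma> + 1) / 2)]))"
    by (simp add: coset_norm_def mult.assoc)
  also have "\<dots> = coset_norm \<tau>"
    unfolding assms(2,3) using nz
    by (simp add: coset_norm_def mult.assoc modular_ratio_fricke)
  finally show ?thesis .
qed

lemma coset_norm_plus_1: "coset_norm (\<tau> + 1) = coset_norm \<tau>"
proof -
  have "hauptmodul13 (2 * (\<tau> + 1)) = hauptmodul13 (2 * \<tau>)"
    using hauptmodul13_plus_int[of "2 * \<tau>" 2] by (simp add: distrib_left)
  moreover have "hauptmodul13 ((\<tau> + 1 + 1) / 2) = hauptmodul13 (\<tau> / 2)"
    using hauptmodul13_plus_1[of "\<tau> / 2"] by (simp add: add_divide_distrib add.assoc)
  ultimately show ?thesis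
    by (simp add: coset_norm_def hauptmodul13_plus_1)
qed

lemma coset_norm_plus_int: "coset_norm (\<tau> + of_int n) = coset_norm \<tau>"
proof (induction n rule: int_induct[where k = 0])
  case (step1 i)
  then show ?case using coset_norm_plus_1[of "\<tau> + of_int i"] by (simp add: add.assoc)
next
  case (step2 i)
  then show ?case using coset_norm_plus_1[of "\<tau> + of_int (i - 1)"] by (simp add: add.assoc)
qed simp

text \<open>The transforms \<tau>/2 and 2\<tau> are exchanged, and (\<tau> + 1)/2 is moved by
  \<open>atkin_lehner2\<close>.\<close>

lemma coset_norm_fricke:
  assumes "Im \<tau> > 0"
  shows "coset_norm (- 1 / (13 * \<tau>)) = coset_norm \<tau>"
proof (rule coset_norm_transform[OF assms hauptmodul13_fricke[OF assms]])
  let ?\<sigma> = "- 1 / (13 * \<tau>)"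
  have nz: "\<tau> \<noteq> 0" "26 * \<tau> \<noteq> 0" using assms by auto
  have "2 * ?\<sigma> = - 1 / (13 * (\<tau> / 2))" "?\<sigma> / 2 = - 1 / (13 * (2 * \<tau>))" by simp_all
  then have 1: "hauptmodul13 (2 * ?\<sigma>) = 13 / hauptmodul13 (\<tau> / 2)"
    and 2: "hauptmodul13 (?\<sigma> / 2) = 13 / hauptmodul13 (2 * \<tau>)"
    using hauptmodul13_fricke[of "\<tau> / 2"] hauptmodul13_fricke[of "2 * \<tau>"] assms by simp_all
  have "(?\<sigma> + 1) / 2 = (13 * \<tau> - 1) / (26 * \<tau>)" using nz by (simp add: field_simps)
  also have "\<dots> = atkin_lehner2 ((\<tau> + 1) / 2)"
    using moebius_compose[of 0 \<tau> 2 13 1 1 "- 7" 26 "- 13"] by (simp add: atkin_lehner2_def)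
  finally have "hauptmodul13 ((?\<sigma> + 1) / 2) = 13 / hauptmodul13 ((\<tau> + 1) / 2)"
    using hauptmodul13_atkin_lehner2[of "(\<tau> + 1) / 2"] assms by simp
  then show "mset [hauptmodul13 (2 * ?\<sigma>), hauptmodul13 (?\<sigma> / 2), hauptmodul13 ((?\<sigma> + 1) / 2)]
    = mset [13 / hauptmodul13 (2 * \<tau>), 13 / hauptmodul13 (\<tau> / 2), 13 / hauptmodul13 ((\<tau> + 1) / 2)]"
    using 1 2 by (simp add: add_mset_commute)
qed

text \<open>2\<tau> is kept and the two halves are exchanged, up to maps for which the effect on
  \<open>hauptmodul13\<close> is known.\<close>

lemma coset_norm_atkin_lehner2:
  assumes "Im \<tau> > 0"
  shows "coset_norm (atkin_lehner2 \<tau>) = coset_norm \<tau>"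
proof (rule coset_norm_transform[OF assms hauptmodul13_atkin_lehner2[OF assms]])
  let ?\<sigma> = "atkin_lehner2 \<tau>"
  have nz: "26 * \<tau> - 13 \<noteq> 0" "2 * \<tau> - 1 \<noteq> 0"
    using upper_half_plane_neq_real[OF assms, of 26 "- 13"] upper_half_plane_neq_real[OF assms, of 2 "- 1"]
    by auto
  have "2 * ?\<sigma> = - 1 / (13 * (2 * \<tau> - 1)) + 1"
    using nz by (simp add: atkin_lehner2_def field_simps)
  then have "hauptmodul13 (2 * ?\<sigma>) = hauptmodul13 (- 1 / (13 * (2 * \<tau> - 1)))"
    by (simp only: hauptmodul13_plus_1)
  also have "\<dots> = 13 / hauptmodul13 (2 * \<tau> - 1)"
    using assms by (intro hauptmodul13_fricke) simp
  finally have 1: "hauptmodul13 (2 * ?\<sigma>) = 13 / hauptmodul13 (2 * \<tau>)"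
    by (simp only: hauptmodul13_minus_1)
  have "?\<sigma> / 2 = (13 * \<tau> - 7) / (52 * \<tau> - 26)"
    using nz by (simp add: atkin_lehner2_def field_simps)
  also have "\<dots> = (13 * ((\<tau> + 1) / 2) - 10) / (52 * ((\<tau> + 1) / 2) - 39)"
    using moebius_compose[of 0 \<tau> 2 13 1 1 "- 10" 52 "- 39"] nz by (simp add: field_simps)
  finally have eq: "?\<sigma> / 2 = (13 * ((\<tau> + 1) / 2) - 10) / (52 * ((\<tau> + 1) / 2) - 39)" .
  have 2: "hauptmodul13 (?\<sigma> / 2) = 13 / hauptmodul13 ((\<tau> + 1) / 2)"
    unfolding eq using hauptmodul13_center_three_quarters[of "(\<tau> + 1) / 2"] assms by simp
  have "(?\<sigma> + 1) / 2 = (39 * \<tau> - 20) / (52 * \<tau> - 26)"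
    using nz by (simp add: atkin_lehner2_def field_simps)
  also have "\<dots> = (39 * (\<tau> / 2) - 10) / (52 * (\<tau> / 2) - 13)"
    using moebius_compose[of 0 \<tau> 2 39 1 0 "- 10" 52 "- 13"] nz by (simp add: field_simps)
  finally have eq: "(?\<sigma> + 1) / 2 = (39 * (\<tau> / 2) - 10) / (52 * (\<tau> / 2) - 13)" .
  have 3: "hauptmodul13 ((?\<sigma> + 1) / 2) = 13 / hauptmodul13 (\<tau> / 2)"
    unfolding eq using hauptmodul13_center_quarter[of "\<tau> / 2"] assms by simp
  show "mset [hauptmodul13 (2 * ?\<sigma>), hauptmodul13 (?\<sigma> / 2), hauptmodul13 ((?\<sigma> + 1) / 2)]
    = mset [13 / hauptmodul13 (2 * \<tau>), 13 / hauptmodul13 (\<tau> / 2), 13 / hauptmodul13 ((\<tau> + 1) / 2)]"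
    unfolding 1 2 3 by (simp add: add_mset_commute)
qed

text \<open>Here 2\<tau> and (\<tau> + 1)/2 change places and \<tau>/2 is kept.\<close>

lemma coset_norm_atkin_lehner3:
  assumes "Im \<tau> > 0"
  shows "coset_norm (atkin_lehner3 \<tau>) = coset_norm \<tau>"
proof (rule coset_norm_transform[OF assms hauptmodul13_atkin_lehner3[OF assms]])
  let ?\<sigma> = "atkin_lehner3 \<tau>"
  let ?x = "(\<tau> + 1) / 2 - 1"
  have nz: "39 * \<tau> - 13 \<noteq> 0" "3 * \<tau> - 1 \<noteq> 0"
    using upper_half_plane_neq_real[OF assms, of 39 "- 13"] upper_half_plane_neq_real[OF assms, of 3 "- 1"]
    by auto
  have x: "Im ?x > 0" using assms by simp
  have "atkin_lehner3' ?x = (13 * \<tau> - 5) / (39 * \<tau> - 13)"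
  proof -
    have eq: "?x = (1 * \<tau> + (- 1)) / (0 * \<tau> + 2)" by (simp add: field_simps)
    show ?thesis
      unfolding eq using moebius_compose[of 0 \<tau> 2 13 1 "- 1" 4 39 13] by (simp add: atkin_lehner3'_def)
  qed
  then have "2 * ?\<sigma> = atkin_lehner3' ?x - 1"
    using nz by (simp add: atkin_lehner3_def field_simps)
  then have "hauptmodul13 (2 * ?\<sigma>) = hauptmodul13 (atkin_lehner3' ?x)"
    by (simp only: hauptmodul13_minus_1)
  also have "\<dots> = 13 / hauptmodul13 ((\<tau> + 1) / 2)"
    by (simp only: hauptmodul13_atkin_lehner3'[OF x] hauptmodul13_minus_1)
  finally have 1: "hauptmodul13 (2 * ?\<sigma>) = 13 / hauptmodul13 ((\<tau> + 1) / 2)" .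
  have "?\<sigma> / 2 = (- 13 * \<tau> + 4) / (78 * \<tau> - 26)"
    using nz by (simp add: atkin_lehner3_def field_simps)
  also have "\<dots> = (- 13 * (\<tau> / 2) + 2) / (78 * (\<tau> / 2) - 13)"
    using moebius_compose[of 0 \<tau> 2 "- 13" 1 0 2 78 "- 13"] nz by (simp add: field_simps)
  finally have eq: "?\<sigma> / 2 = (- 13 * (\<tau> / 2) + 2) / (78 * (\<tau> / 2) - 13)" .
  have 2: "hauptmodul13 (?\<sigma> / 2) = 13 / hauptmodul13 (\<tau> / 2)"
    unfolding eq using hauptmodul13_center_sixth[of "\<tau> / 2"] assms by simp
  have "(?\<sigma> + 1) / 2 = (26 * \<tau> - 9) / (78 * \<tau> - 26)"
    using nz by (simp add: atkin_lehner3_def field_simps)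
  also have "\<dots> = atkin_lehner3' (2 * \<tau> - 1)"
    by (simp add: atkin_lehner3'_def algebra_simps)
  finally have "hauptmodul13 ((?\<sigma> + 1) / 2) = 13 / hauptmodul13 (2 * \<tau> - 1)"
    using hauptmodul13_atkin_lehner3'[of "2 * \<tau> - 1"] assms by simp
  then have 3: "hauptmodul13 ((?\<sigma> + 1) / 2) = 13 / hauptmodul13 (2 * \<tau>)"
    by (simp only: hauptmodul13_minus_1)
  show "mset [hauptmodul13 (2 * ?\<sigma>), hauptmodul13 (?\<sigma> / 2), hauptmodul13 ((?\<sigma> + 1) / 2)]
    = mset [13 / hauptmodul13 (2 * \<tau>), 13 / hauptmodul13 (\<tau> / 2), 13 / hauptmodul13 ((\<tau> + 1) / 2)]"
    unfolding 1 2 3 by (simp add: add_mset_commute)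
qed

lemma coset_norm_atkin_lehner3':
  assumes "Im \<tau> > 0"
  shows "coset_norm (atkin_lehner3' \<tau>) = coset_norm \<tau>"
proof -
  have "39 * \<tau> + 13 \<noteq> 0"
    using upper_half_plane_neq_real[OF assms, of 39 13] by simp
  then have "atkin_lehner3 (atkin_lehner3' \<tau>) = \<tau>"
    using moebius_compose[of 39 \<tau> 13 "- 13" 13 4 4 39 "- 13"]
    by (simp add: atkin_lehner3_def atkin_lehner3'_def)
  then show ?thesis
    using coset_norm_atkin_lehner3[OF Im_atkin_lehner3'[OF assms]] by simp
qed

section \<open>Raising points to height 1/20\<close>

lemma square_le_square:
  fixes u k :: real
  assumes "\<bar>u\<bar> \<le> k"
  shows "u\<^sup>2 \<le> k\<^sup>2"
  using assms by (simp add: abs_le_square_iff [symmetric])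

text \<open>The height is multiplied by the determinant over \<open>|c \<tau> + d|^2\<close>, and
  260/21 is the value for which 13 over it equals 21/20.\<close>

lemma Im_moebius_ge:
  fixes a b c d p r :: real
  assumes "Im \<tau> > 0" "a * d - b * c \<ge> 13" "c > 0"
    "- p \<le> c * Re \<tau> + d" "c * Re \<tau> + d \<le> p" "c * Im \<tau> \<le> r"
    "p\<^sup>2 + r\<^sup>2 \<le> 260 / 21"
  shows "Im ((of_real a * \<tau> + of_real b) / (of_real c * \<tau> + of_real d)) \<ge> 21 / 20 * Im \<tau>"
proof -
  let ?D = "(c * Re \<tau> + d)\<^sup>2 + (c * Im \<tau>)\<^sup>2"
  have D: "?D \<le> 260 / 21"
  proof -
    have "(c * Re \<tau> + d)\<^sup>2 \<le> p\<^sup>2"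
      using assms(4,5) by (intro square_le_square) (simp add: abs_le_iff)
    moreover have "(c * Im \<tau>)\<^sup>2 \<le> r\<^sup>2"
      using assms(1,3,6) by (intro square_le_square) (simp add: abs_mult)
    ultimately show ?thesis using assms(7) by linarith
  qed
  have "c * Im \<tau> \<noteq> 0" using assms by simp
  then have "?D > 0" by (simp add: add_nonneg_pos)
  moreover have "21 / 20 * Im \<tau> * ?D \<le> (a * d - b * c) * Im \<tau>"
  proof -
    have "21 / 20 * Im \<tau> * ?D \<le> 21 / 20 * Im \<tau> * (260 / 21)"
      using D assms(1) by (intro mult_left_mono) auto
    also have "\<dots> = 13 * Im \<tau>" by simp
    also have "\<dots> \<le> (a * d - b * c) * Im \<tau>"
      using assms by (intro mult_right_mono) auto
    finally show ?thesis .
  qed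
  ultimately show ?thesis
    unfolding Im_moebius by (simp add: pos_le_divide_eq)
qed

text \<open>The isometric circles with centres \<open>0\<close>, \<open>\<plusminus>1/3\<close> and \<open>\<plusminus>1/2\<close> cover the strip \<open>\<bar>Re \<tau>\<bar> \<le> 1/2\<close> below height
  \<open>1/20\<close>, with a margin that gives the uniform factor \<open>21/20\<close>.\<close>

lemma coset_norm_raise_height:
  assumes "Im \<tau> > 0" "Im \<tau> \<le> 1 / 20"
  shows "\<exists>\<sigma>. Im \<sigma> \<ge> 21 / 20 * Im \<tau> \<and> coset_norm \<sigma> = coset_norm \<tau>"
proof -
  define \<rho> where "\<rho> = \<tau> - of_int (round (Re \<tau>))"
  have eq: "coset_norm \<rho> = coset_norm \<tau>"
    using coset_norm_plus_int[of \<tau> "- round (Re \<tau>)"] by (simp add: \<rho>_def)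
  have Im: "Im \<rho> = Im \<tau>" by (simp add: \<rho>_def)
  have pos: "Im \<rho> > 0" and le: "Im \<rho> \<le> 1 / 20" using assms Im by simp_all
  have "\<bar>Re \<rho>\<bar> \<le> 1 / 2"
    using of_int_round_abs_le[of "Re \<tau>"] by (simp add: \<rho>_def abs_minus_commute)
  \<comment> \<open>The cut 53/200 lies between the circles about 0 and 1/3, and 2/5 between those
    about 1/3 and 1/2. In each case \<open>p\<close> and \<open>r\<close> below bound the real and
    imaginary parts of \<open>c \<rho> + d\<close>; the circle about 0 is tightest, with
    \<open>p^2 + r^2\<close> about 12.29 against 12.38.\<close>
  then consider "Re \<rho> \<le> 53/200" "- (53/200) \<le> Re \<rho>" | "53/200 \<le> Re \<rho>" "Re \<rho> \<le> 2/5" | "2/5 \<le> Re \<rho>" "Re \<rho> \<le> 1/2"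
    | "Re \<rho> \<le> - (53/200)" "- (2/5) \<le> Re \<rho>" | "Re \<rho> \<le> - (2/5)" "- (1/2) \<le> Re \<rho>"
    by linarith
  then have "\<exists>\<sigma>. Im \<sigma> \<ge> 21 / 20 * Im \<rho> \<and> coset_norm \<sigma> = coset_norm \<rho>"
  proof cases
    case 1
    have "Im ((of_real 0 * \<rho> + of_real (- 1)) / (of_real 13 * \<rho> + of_real 0)) \<ge> 21 / 20 * Im \<rho>"
      by (rule Im_moebius_ge[OF pos, where p = "689/200" and r = "13/20"])
        (use 1 pos le in \<open>simp_all add: power2_eq_square abs_le_iff\<close>)
    then show ?thesis
      using coset_norm_fricke[OF pos] by (intro exI[of _ "- 1 / (13 * \<rho>)"]) simp
  next
    case 2
    have "Im ((of_real (- 13) * \<rho> + of_real 4) / (of_real 39 * \<rho> + of_real (- 13))) \<ge> 21 / 20 * Im \<rho>"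
      by (rule Im_moebius_ge[OF pos, where p = "533/200" and r = "39/20"])
        (use 2 pos le in \<open>simp_all add: power2_eq_square\<close>)
    then show ?thesis
      using coset_norm_atkin_lehner3[OF pos] by (intro exI[of _ "atkin_lehner3 \<rho>"]) (simp add: atkin_lehner3_def)
  next
    case 3
    have "Im ((of_real 13 * \<rho> + of_real (- 7)) / (of_real 26 * \<rho> + of_real (- 13))) \<ge> 21 / 20 * Im \<rho>"
      by (rule Im_moebius_ge[OF pos, where p = "13/5" and r = "13/10"])
        (use 3 pos le in \<open>simp_all add: power2_eq_square\<close>)
    then show ?thesis
      using coset_norm_atkin_lehner2[OF pos] by (intro exI[of _ "atkin_lehner2 \<rho>"]) (simp add: atkin_lehner2_def)
  next
    case 4
    have "Im ((of_real 13 * \<rho> + of_real 4) / (of_real 39 * \<rho> + of_real 13)) \<ge> 21 / 20 * Im \<rho>"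
      by (rule Im_moebius_ge[OF pos, where p = "533/200" and r = "39/20"])
        (use 4 pos le in \<open>simp_all add: power2_eq_square\<close>)
    then show ?thesis
      using coset_norm_atkin_lehner3'[OF pos] by (intro exI[of _ "atkin_lehner3' \<rho>"]) (simp add: atkin_lehner3'_def)
  next
    case 5
    \<comment> \<open>A unit translation brings this range next to the centre 1/2, so that
      \<open>atkin_lehner2\<close> serves again.\<close>
    have pos': "Im (\<rho> + 1) > 0" using pos by simp
    have "Im ((of_real 13 * (\<rho> + 1) + of_real (- 7)) / (of_real 26 * (\<rho> + 1) + of_real (- 13))) \<ge> 21 / 20 * Im (\<rho> + 1)"
      by (rule Im_moebius_ge[OF pos', where p = "13/5" and r = "13/10"])
        (use 5 pos le in \<open>simp_all add: power2_eq_square\<close>)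
    then show ?thesis
      using coset_norm_atkin_lehner2[OF pos'] coset_norm_plus_1[of \<rho>]
      by (intro exI[of _ "atkin_lehner2 (\<rho> + 1)"]) (simp add: atkin_lehner2_def)
  qed
  then show ?thesis using eq Im by simp
qed

text \<open>Each raise gains the fixed factor 21/20, so finitely many suffice; the induction is on a
  number \<open>n\<close> of raises that is enough. A last translation restores the strip.\<close>

lemma coset_norm_high_representative:
  assumes "Im \<tau> > 0"
  shows "\<exists>\<sigma>. Im \<sigma> \<ge> 1 / 20 \<and> \<bar>Re \<sigma>\<bar> \<le> 1 / 2 \<and> coset_norm \<sigma> = coset_norm \<tau>"
proof -
  have *: "\<exists>\<sigma>. Im \<sigma> \<ge> 1 / 20 \<and> coset_norm \<sigma> = coset_norm \<tau>"
    if "Im \<tau> > 0" "1 / 20 \<le> (21 / 20) ^ n * Im \<tau>" for n \<tau>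
    using that
  proof (induction n arbitrary: \<tau>)
    case (Suc n)
    show ?case
    proof (cases "Im \<tau> \<ge> 1 / 20")
      case False
      then obtain \<sigma> where \<sigma>: "Im \<sigma> \<ge> 21 / 20 * Im \<tau>" "coset_norm \<sigma> = coset_norm \<tau>"
        using coset_norm_raise_height[of \<tau>] Suc.prems by force
      have "(21 / 20) ^ n * (21 / 20 * Im \<tau>) \<le> (21 / 20) ^ n * Im \<sigma>"
        using \<sigma> by (intro mult_left_mono) auto
      moreover have "(21 / 20) ^ Suc n * Im \<tau> = (21 / 20) ^ n * (21 / 20 * Im \<tau>)"
        by (simp only: power_Suc mult_ac)
      ultimately have "1 / 20 \<le> (21 / 20) ^ n * Im \<sigma>" using Suc.prems by linarith
      moreover have "Im \<sigma> > 0" using \<sigma> Suc.prems by linarith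
      ultimately show ?thesis using Suc.IH[of \<sigma>] \<sigma>(2) by simp
    qed auto
  qed auto
  obtain n where "1 / 20 / Im \<tau> < (21 / 20) ^ n"
    using real_arch_pow[of "21 / 20" "1 / 20 / Im \<tau>"] by auto
  then have "1 / 20 \<le> (21 / 20) ^ n * Im \<tau>"
    using assms by (simp add: field_simps)
  with *[OF assms] obtain \<sigma> where \<sigma>: "Im \<sigma> \<ge> 1 / 20" "coset_norm \<sigma> = coset_norm \<tau>" by blast
  have "coset_norm (\<sigma> + of_int (- round (Re \<sigma>))) = coset_norm \<tau>"
    unfolding coset_norm_plus_int by (rule \<sigma>(2))
  moreover have "\<bar>Re (\<sigma> + of_int (- round (Re \<sigma>)))\<bar> \<le> 1 / 2"
    using of_int_round_abs_le[of "Re \<sigma>"] by (simp add: abs_minus_commute)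
  ultimately show ?thesis
    using \<sigma>(1) by (intro exI[of _ "\<sigma> + of_int (- round (Re \<sigma>))"]) simp
qed

section \<open>Behaviour at the cusp\<close>

definition hauptmodul13_series :: "complex \<Rightarrow> complex" where
  "hauptmodul13_series q = (qpochhammer_inf q q / qpochhammer_inf (q ^ 13) (q ^ 13)) ^ 2"

lemma hauptmodul13_series_holomorphic: "hauptmodul13_series holomorphic_on ball 0 1"
  unfolding hauptmodul13_series_def
  by (intro holomorphic_intros qpochhammer_holomorphic)
    (auto simp: norm_power power_less_one_iff qpochhammer_nonzero)

lemma hauptmodul13_series_0 [simp]: "hauptmodul13_series 0 = 1"
  by (simp add: hauptmodul13_series_def)

text \<open>The denominator is 1 to first order, so the series begins like the square of
  \<open>1 - q\<close>.\<close>

lemma hauptmodul13_series_derivative_0: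
  "(hauptmodul13_series has_field_derivative - 2) (at 0)"
proof -
  have 0: "((\<lambda>q. qpochhammer_inf q q) has_field_derivative - 1) (at (0 ^ 13))"
    using qpochhammer_diagonal_has_field_derivative_0 by simp
  have "((\<lambda>q::complex. q ^ 13) has_field_derivative 0) (at 0)"
    by (auto intro!: derivative_eq_intros)
  from DERIV_chain2[OF 0 this]
  have 13: "((\<lambda>q. qpochhammer_inf (q ^ 13) (q ^ 13)) has_field_derivative 0) (at 0)" by simp
  show ?thesis
    unfolding hauptmodul13_series_def
    by (rule derivative_eq_intros refl qpochhammer_diagonal_has_field_derivative_0 13)+ simp_all
qed

lemma hauptmodul13_conv_series:
  "hauptmodul13 \<tau> = hauptmodul13_series (nome \<tau>) / nome \<tau>"
proof -
  have "nome (13 * \<tau> / 12) = nome (\<tau> / 12) * nome \<tau>"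
    unfolding nome_add [symmetric] by (rule arg_cong[where f = nome]) (simp add: field_simps)
  moreover have "nome (13 * \<tau>) = nome \<tau> ^ 13"
    by (simp add: nome_power)
  ultimately show ?thesis
    by (simp add: hauptmodul13_def eta_sq_def hauptmodul13_series_def power_divide)
qed

lemma hauptmodul13_holomorphic: "hauptmodul13 holomorphic_on {\<tau>. Im \<tau> > 0}"
proof -
  have "(eta_sq \<circ> (\<lambda>\<tau>. 13 * \<tau>)) holomorphic_on {\<tau>. Im \<tau> > 0}"
    by (intro holomorphic_on_compose_gen[OF _ eta_sq_holomorphic] holomorphic_intros) auto
  then show ?thesis
    unfolding hauptmodul13_def
    by (intro holomorphic_intros eta_sq_holomorphic) (auto simp: o_def eta_sq_nonzero)
qed

lemma hauptmodul13_compose_holomorphic: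
  assumes "f holomorphic_on S" "\<And>z. z \<in> S \<Longrightarrow> Im (f z) > 0"
  shows "(\<lambda>z. hauptmodul13 (f z)) holomorphic_on S"
proof -
  have "(hauptmodul13 \<circ> f) holomorphic_on S"
    using assms by (intro holomorphic_on_compose_gen[OF _ hauptmodul13_holomorphic]) auto
  then show ?thesis by (simp add: o_def)
qed

lemma coset_norm_holomorphic: "coset_norm holomorphic_on {\<tau>. Im \<tau> > 0}"
  unfolding coset_norm_def modular_ratio_def modular_eq2_def
  by (intro holomorphic_intros hauptmodul13_compose_holomorphic) (auto simp: hauptmodul13_nonzero)

definition cusp_ratio :: "complex \<Rightarrow> complex" where
  "cusp_ratio q = modular_ratio (hauptmodul13_series q / q) (hauptmodul13_series (q\<^sup>2) / q\<^sup>2)"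

text \<open>The arguments have poles of order 1 and 2, so \<open>modular_eq2\<close> could have one
  of order 6. Its two leading coefficients vanish, so the squared numerator is
  \<open>O(q^(-8))\<close> against a denominator of exact order \<open>q^(-9)\<close>, and the ratio
  is \<open>O(q)\<close>.\<close>

lemma cusp_ratio_tendsto_0: "(cusp_ratio \<longlongrightarrow> 0) (at 0)"
proof -
  let ?a = hauptmodul13_series
  define b where "b = (\<lambda>q. ?a (q\<^sup>2))"
  \<comment> \<open>\<open>N\<close> is \<open>modular_eq2\<close> of the two arguments, multiplied
    by \<open>q^6\<close>.\<close>
  define N where "N = (\<lambda>q. ?a q ^ 2 * b q ^ 2 + 13 * q ^ 3 * ?a q * b q - b q ^ 3 + 4 * q * ?a q * b q ^ 2
    + 4 * q ^ 2 * ?a q ^ 2 * b q - q ^ 3 * ?a q ^ 3)"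
  have a2: "(?a has_field_derivative - 2) (at (0\<^sup>2))"
    using hauptmodul13_series_derivative_0 by simp
  have "((\<lambda>q::complex. q\<^sup>2) has_field_derivative 0) (at 0)"
    by (auto intro!: derivative_eq_intros)
  from DERIV_chain2[OF a2 this] have db: "(b has_field_derivative 0) (at 0)"
    by (simp add: b_def)
  have b0: "b 0 = 1" by (simp add: b_def)
  have b_hol: "b holomorphic_on ball 0 1"
  proof -
    have "(?a \<circ> (\<lambda>q. q\<^sup>2)) holomorphic_on ball 0 1"
      by (intro holomorphic_on_compose_gen[OF _ hauptmodul13_series_holomorphic] holomorphic_intros)
        (auto simp: norm_power power_less_one_iff)
    then show ?thesis by (simp add: b_def o_def)
  qed
  have N_hol: "N holomorphic_on ball 0 1"
    unfolding N_def by (intro holomorphic_intros hauptmodul13_series_holomorphic b_hol)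
  \<comment> \<open>The slope -4 of the square of the series cancels against the +4 from
    \<open>4 * q * ?a q * b q ^ 2\<close>.\<close>
  have dN: "(N has_field_derivative 0) (at 0)"
    unfolding N_def
    by (rule derivative_eq_intros refl hauptmodul13_series_derivative_0 db)+ (simp add: b0)
  have N0: "N 0 = 0" by (simp add: N_def b0)
  \<comment> \<open>\<open>M\<close> is \<open>N q / q\<close> with the removable singularity filled
    in. Since it vanishes at 0 too, a second division by \<open>q\<close> still has a limit.\<close>
  define M where "M = (\<lambda>q. if q = 0 then deriv N 0 else (N q - N 0) / (q - 0))"
  have M_hol: "M holomorphic_on ball 0 1"
    unfolding M_def by (rule pole_lemma[OF N_hol]) simp
  then have dM: "(M has_field_derivative deriv M 0) (at 0)"
    by (intro holomorphic_derivI[of M "ball 0 1"]) auto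
  have M0: "M 0 = 0" using DERIV_imp_deriv[OF dN] by (simp add: M_def)
  have lim: "((\<lambda>q. M q / q) \<longlongrightarrow> deriv M 0) (at 0)"
    using dM by (simp add: DERIV_def M0)
  have ca: "(?a \<longlongrightarrow> 1) (at 0)"
    using DERIV_isCont[OF hauptmodul13_series_derivative_0] by (simp add: isCont_def)
  have cb: "(b \<longlongrightarrow> 1) (at 0)"
    using DERIV_isCont[OF db] by (simp add: isCont_def b0)
  have "((\<lambda>q. q * (M q / q) ^ 2 / (?a q * b q) ^ 3) \<longlongrightarrow> 0 * deriv M 0 ^ 2 / (1 * 1) ^ 3) (at 0)"
    by (intro tendsto_intros lim ca cb) auto
  then have lim0: "((\<lambda>q. q * (M q / q) ^ 2 / (?a q * b q) ^ 3) \<longlongrightarrow> 0) (at 0)" by simp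
  have "eventually (\<lambda>q. q \<in> ball 0 1 - {0}) (at (0::complex))"
    by (intro eventually_at_in_open) auto
  then have "eventually (\<lambda>q. q * (M q / q) ^ 2 / (?a q * b q) ^ 3 = cusp_ratio q) (at 0)"
  proof eventually_elim
    case (elim q)
    then have q: "q \<noteq> 0" by simp
    have eq: "modular_eq2 (?a q / q) (b q / q\<^sup>2) = N q / q ^ 6"
      using q by (simp add: modular_eq2_def N_def field_simps eval_nat_numeral)
    have "M q / q = N q / q\<^sup>2"
      using q by (simp add: M_def N0 power2_eq_square)
    moreover have "cusp_ratio q = (N q / q ^ 6) ^ 2 / ((?a q / q) * (b q / q\<^sup>2)) ^ 3"
      by (simp only: cusp_ratio_def modular_ratio_def eq [unfolded b_def] b_def)
    moreover have "q * (n / q\<^sup>2) ^ 2 / (x * y) ^ 3 = (n / q ^ 6) ^ 2 / ((x / q) * (y / q\<^sup>2)) ^ 3" for n x y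
      using q by (simp add: field_simps eval_nat_numeral)
    ultimately show ?case by (simp only:)
  qed
  with lim0 show ?thesis by (rule Lim_transform_eventually)
qed

lemma modular_ratio_conv_cusp_ratio:
  "modular_ratio (hauptmodul13 \<tau>) (hauptmodul13 (2 * \<tau>)) = cusp_ratio (nome \<tau>)"
proof -
  have "nome (2 * \<tau>) = nome \<tau> ^ 2" by (simp add: nome_power)
  then show ?thesis by (simp add: hauptmodul13_conv_series cusp_ratio_def)
qed

text \<open>By symmetry of \<open>modular_ratio\<close>, the factors for \<tau>/2 and (\<tau> + 1)/2
  are the factor for 2\<tau> taken at those points, so one limit in \<open>q\<close> controls all
  three.\<close>

lemma coset_norm_conv_cusp_ratio:
  "coset_norm \<tau> = cusp_ratio (nome \<tau>) * cusp_ratio (nome (\<tau> / 2)) * cusp_ratio (nome ((\<tau> + 1) / 2))"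
proof -
  have "2 * ((\<tau> + 1) / 2) = \<tau> + 1" "2 * (\<tau> / 2) = \<tau>" by (simp_all add: field_simps)
  then have "modular_ratio (hauptmodul13 ((\<tau> + 1) / 2)) (hauptmodul13 \<tau>) = cusp_ratio (nome ((\<tau> + 1) / 2))"
    "modular_ratio (hauptmodul13 (\<tau> / 2)) (hauptmodul13 \<tau>) = cusp_ratio (nome (\<tau> / 2))"
    using modular_ratio_conv_cusp_ratio[of "(\<tau> + 1) / 2"] modular_ratio_conv_cusp_ratio[of "\<tau> / 2"]
    by (simp_all only: hauptmodul13_plus_1)
  then show ?thesis
    unfolding coset_norm_def modular_ratio_conv_cusp_ratio by (simp only: modular_ratio_commute)
qed

lemma norm_nome_small:
  assumes "d > 0"
  shows "\<exists>Y. \<forall>\<tau>. Im \<tau> > Y \<longrightarrow> norm (nome \<tau>) < d"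
proof (intro exI allI impI)
  fix \<tau> assume "Im \<tau> > - ln d / (2 * pi)"
  then have "- 2 * pi * Im \<tau> < ln d"
    by (simp add: field_simps)
  then show "norm (nome \<tau>) < d"
    using assms unfolding norm_nome by (metis exp_less_cancel_iff exp_ln)
qed

lemma coset_norm_small:
  assumes "e > 0"
  shows "\<exists>Y. \<forall>\<tau>. Im \<tau> > Y \<longrightarrow> norm (coset_norm \<tau>) < e"
proof -
  \<comment> \<open>The minimum lets two factors be bounded by 1 and the remaining one by
    \<open>e\<close>.\<close>
  have "\<exists>d>0. \<forall>q. q \<noteq> 0 \<and> dist q 0 < d \<longrightarrow> dist (cusp_ratio q) 0 < min 1 e"
    using cusp_ratio_tendsto_0 assms unfolding LIM_def by (metis min_less_iff_conj zero_less_one)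
  then obtain d where d: "d > 0" "\<And>q. q \<noteq> 0 \<Longrightarrow> norm q < d \<Longrightarrow> norm (cusp_ratio q) < min 1 e"
    by auto
  obtain Y where Y: "\<And>\<tau>. Im \<tau> > Y \<Longrightarrow> norm (nome \<tau>) < d"
    using norm_nome_small[OF d(1)] by blast
  have small: "norm (cusp_ratio (nome \<tau>)) < min 1 e" if "Im \<tau> > Y" for \<tau>
    using d(2)[OF _ Y[OF that]] by simp
  \<comment> \<open>The halved arguments need twice the height; the 0 covers negative
    \<open>Y\<close>.\<close>
  have "norm (coset_norm \<tau>) < e" if "Im \<tau> > max 0 (2 * Y)" for \<tau>
  proof -
    have Y: "Im \<tau> > Y" "Im (\<tau> / 2) > Y" "Im ((\<tau> + 1) / 2) > Y" using that by auto
    have "norm (coset_norm \<tau>) = norm (cusp_ratio (nome \<tau>)) * norm (cusp_ratio (nome (\<tau> / 2)))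
        * norm (cusp_ratio (nome ((\<tau> + 1) / 2)))"
      by (simp add: coset_norm_conv_cusp_ratio norm_mult)
    also have "\<dots> \<le> norm (cusp_ratio (nome \<tau>)) * 1 * 1"
      using small[OF Y(2)] small[OF Y(3)] by (intro mult_mono) auto
    also have "\<dots> < e" using small[OF Y(1)] by simp
    finally show ?thesis .
  qed
  then show ?thesis by blast
qed

text \<open>Were the value at \<tau> nonzero, points above height \<open>Y\<close> would have
  smaller modulus, so the supremum over the half plane would be attained on a compact rectangle. The
  maximum principle then gives a constant, contradicting the smaller modulus high up.\<close>

lemma coset_norm_eq_0:
  assumes "Im \<tau> > 0"
  shows "coset_norm \<tau> = 0"
proof (rule ccontr)
  assume nz: "coset_norm \<tau> \<noteq> 0"
  then obtain Y where Y: "\<And>\<sigma>. Im \<sigma> > Y \<Longrightarrow> norm (coset_norm \<sigma>) < norm (coset_norm \<tau>)"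
    using coset_norm_small[of "norm (coset_norm \<tau>)"] by auto
  define K where "K = cbox (Complex (- 1 / 2) (1 / 20)) (Complex (1 / 2) Y)"
  have K: "\<sigma> \<in> K \<longleftrightarrow> \<bar>Re \<sigma>\<bar> \<le> 1 / 2 \<and> 1 / 20 \<le> Im \<sigma> \<and> Im \<sigma> \<le> Y" for \<sigma>
    by (auto simp: K_def in_cbox_complex_iff)
  have "compact K" by (simp add: K_def)
  \<comment> \<open>This representative shows that the rectangle is nonempty and that its maximum is
    at least the modulus at \<tau>.\<close>
  obtain \<tau>' where \<tau>': "Im \<tau>' \<ge> 1 / 20" "\<bar>Re \<tau>'\<bar> \<le> 1 / 2" "coset_norm \<tau>' = coset_norm \<tau>"
    using coset_norm_high_representative[OF assms] by blast
  have "\<not> Im \<tau>' > Y" using Y[of \<tau>'] \<tau>'(3) by auto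
  then have "\<tau>' \<in> K" using \<tau>' by (simp add: K)
  have sub: "K \<subseteq> {\<tau>. Im \<tau> > 0}" by (auto simp: K)
  have "continuous_on K (\<lambda>z. norm (coset_norm z))"
    by (intro continuous_on_norm continuous_on_subset[OF holomorphic_on_imp_continuous_on[OF coset_norm_holomorphic] sub])
  then obtain m where m: "m \<in> K" "\<And>z. z \<in> K \<Longrightarrow> norm (coset_norm z) \<le> norm (coset_norm m)"
    using continuous_attains_sup[OF \<open>compact K\<close>] \<open>\<tau>' \<in> K\<close> by blast
  have max: "norm (coset_norm z) \<le> norm (coset_norm m)" if z: "Im z > 0" for z
  proof -
    obtain w where w: "Im w \<ge> 1 / 20" "\<bar>Re w\<bar> \<le> 1 / 2" "coset_norm w = coset_norm z"
      using coset_norm_high_representative[OF z] by blast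
    show ?thesis
    proof (cases "Im w \<le> Y")
      case True
      then show ?thesis using m(2)[of w] w by (simp add: K)
    next
      case False
      then have "norm (coset_norm w) < norm (coset_norm \<tau>)" by (intro Y) simp
      also have "\<dots> \<le> norm (coset_norm m)" using m(2)[OF \<open>\<tau>' \<in> K\<close>] \<tau>'(3) by simp
      finally show ?thesis using w(3) by simp
    qed
  qed
  have "coset_norm constant_on {\<tau>. Im \<tau> > 0}"
    by (rule maximum_modulus_principle[OF coset_norm_holomorphic open_upper_half_plane
          connected_upper_half_plane open_upper_half_plane order_refl, of m])
      (use m(1) sub max in auto)
  then obtain c where c: "\<And>z. Im z > 0 \<Longrightarrow> coset_norm z = c"
    by (auto simp: constant_on_def)
  define h where "h = Complex 0 (\<bar>Y\<bar> + 1)"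
  have "Im h > Y" "Im h > 0" by (auto simp: h_def)
  then show False using Y[of h] c[of h] c[OF assms] by simp
qed

text \<open>If \<open>f\<close> is not identically 0, then \<open>g\<close> vanishes on the nonempty
  open set where \<open>f\<close> does not, hence everywhere by the identity theorem.\<close>

lemma holomorphic_mult_eq_0:
  assumes "f holomorphic_on S" "g holomorphic_on S" "open S" "connected S"
    and "\<And>z. z \<in> S \<Longrightarrow> f z * g z = 0"
  shows "(\<forall>z\<in>S. f z = 0) \<or> (\<forall>z\<in>S. g z = 0)"
proof (rule ccontr)
  assume "\<not> ?thesis"
  then obtain z0 w0 where z0: "z0 \<in> S" "f z0 \<noteq> 0" and w0: "w0 \<in> S" "g w0 \<noteq> 0" by auto
  let ?U = "S \<inter> f -` (- {0})"
  have U: "open ?U"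
    by (rule continuous_open_preimage[OF holomorphic_on_imp_continuous_on[OF assms(1)] assms(3)]) (simp add: open_Compl)
  have "g w0 = 0"
  proof (rule analytic_continuation_open[of ?U S g "\<lambda>_. 0"])
    show "?U \<noteq> {}" using z0 by auto
    show "g z = 0" if "z \<in> ?U" for z using that assms(5)[of z] by simp
  qed (use assms U w0 in simp_all)
  with w0 show False by simp
qed

text \<open>The vanishing norm makes one of its three factors vanish identically. Each is the same
  function at an argument that runs over the whole half plane, so it does not matter which.\<close>

theorem modular_equation_degree_2:
  assumes "Im \<tau> > 0"
  shows "modular_eq2 (hauptmodul13 \<tau>) (hauptmodul13 (2 * \<tau>)) = 0"
proof -
  let ?H = "{\<tau>. Im \<tau> > 0}"
  define k where "k = (\<lambda>\<tau>. modular_eq2 (hauptmodul13 \<tau>) (hauptmodul13 (2 * \<tau>)))"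
  have k_hol: "(\<lambda>z. k (f z)) holomorphic_on ?H"
    if "f holomorphic_on ?H" "\<And>z. Im z > 0 \<Longrightarrow> Im (f z) > 0" for f
    unfolding k_def modular_eq2_def
    using that by (intro holomorphic_intros hauptmodul13_compose_holomorphic) auto
  have "k z * (k (z / 2) * k ((z + 1) / 2)) = 0" if z: "Im z > 0" for z
  proof -
    have "cusp_ratio (nome w) = 0 \<longleftrightarrow> k w = 0" if "Im w > 0" for w
      using that
      by (simp add: modular_ratio_def k_def hauptmodul13_nonzero flip: modular_ratio_conv_cusp_ratio)
    then show ?thesis
      using coset_norm_eq_0[OF z] z by (simp add: coset_norm_conv_cusp_ratio)
  qed
  moreover have hol: "(\<lambda>z. k z) holomorphic_on ?H" "(\<lambda>z. k (z / 2)) holomorphic_on ?H"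
    "(\<lambda>z. k ((z + 1) / 2)) holomorphic_on ?H"
    by (rule k_hol; (intro holomorphic_intros)?; simp)+
  ultimately have "(\<forall>z\<in>?H. k z = 0) \<or> (\<forall>z\<in>?H. k (z / 2) * k ((z + 1) / 2) = 0)"
    by (intro holomorphic_mult_eq_0 holomorphic_on_mult open_upper_half_plane connected_upper_half_plane)
      auto
  moreover have "(\<forall>z\<in>?H. k (z / 2) = 0) \<or> (\<forall>z\<in>?H. k ((z + 1) / 2) = 0)"
    if "\<forall>z\<in>?H. k (z / 2) * k ((z + 1) / 2) = 0"
    using that hol
    by (intro holomorphic_mult_eq_0 open_upper_half_plane connected_upper_half_plane) auto
  ultimately consider "\<forall>z\<in>?H. k z = 0" | "\<forall>z\<in>?H. k (z / 2) = 0" | "\<forall>z\<in>?H. k ((z + 1) / 2) = 0"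
    by blast
  then have "k \<tau> = 0"
  proof cases
    case 1
    then show ?thesis using assms by simp
  next
    case 2
    then show ?thesis using bspec[OF 2, of "2 * \<tau>"] assms by simp
  next
    case 3
    then show ?thesis using bspec[OF 3, of "2 * \<tau> - 1"] assms by simp
  qed
  then show ?thesis by (simp add: k_def)
qed

subsection \<open>Elimination\<close>

text \<open>The claimed relation multiplied by \<open>(PQ)\<^sup>4\<close>, in terms of \<open>a = P\<^sup>2\<close> and \<open>b = Q\<^sup>2\<close>.\<close>

definition pq_relation :: "complex \<Rightarrow> complex \<Rightarrow> complex" where
  "pq_relation a b = a * b * (a * b + 1)\<^sup>2 - (a * b + 1) * ((a + b) ^ 3 + (a + b) * (a * b))
     + 4 * (a + b)\<^sup>2 * (a * b) - 4 * (a * b)\<^sup>2"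

text \<open>Both equations are quadratic in \<open>y\<close>. One linear combination removes the
  constant terms and another the quadratic terms; \<open>y\<close> drops out when the two are
  multiplied.\<close>

lemma modular_eq2_eliminate:
  assumes y: "y \<noteq> 0" and b: "b \<noteq> 0"
    and 1: "modular_eq2 (a * y) y = 0" and 2: "modular_eq2 y (y / b) = 0"
  shows "pq_relation a b * (1 - a * b)\<^sup>2 = 0"
proof -
  \<comment> \<open>After division by \<open>y^2\<close>, the linear coefficient is this cubic, at
    \<open>a\<close> in the first equation and, once cleared of denominators, at \<open>b\<close> in
    the second.\<close>
  define g where "g = (\<lambda>x::complex. 1 + x ^ 3 - 4 * x - 4 * x\<^sup>2)"
  have "y\<^sup>2 * (a\<^sup>2 * y\<^sup>2 + 13 * a - y * g a) = 0"
    using 1 by (simp add: modular_eq2_def g_def algebra_simps eval_nat_numeral)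
  then have e1: "a\<^sup>2 * y\<^sup>2 + 13 * a = y * g a"
    using y by simp
  have "y\<^sup>2 * (b * y\<^sup>2 + 13 * b\<^sup>2 - y * g b) = b ^ 3 * modular_eq2 y (y / b)"
    using b by (simp add: modular_eq2_def g_def field_simps eval_nat_numeral)
  then have e2: "b * y\<^sup>2 + 13 * b\<^sup>2 = y * g b"
    using y 2 by simp
  have "y * (- (y * (a * b) * (1 - a * b))) = y * (b\<^sup>2 * g a - a * g b)"
    using e1 e2 by algebra
  then have f1: "b\<^sup>2 * g a - a * g b = - (y * (a * b) * (1 - a * b))"
    unfolding mult_left_cancel[OF y] by (rule sym)
  have f2: "y * (b * g a - a\<^sup>2 * g b) = 13 * (a * b) * (1 - a * b)"
    using e1 e2 by algebra
  have "y * ((b\<^sup>2 * g a - a * g b) * (b * g a - a\<^sup>2 * g b) + 13 * (a * b)\<^sup>2 * (1 - a * b)\<^sup>2) = 0"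
    using f1 f2 by algebra
  then have "(b\<^sup>2 * g a - a * g b) * (b * g a - a\<^sup>2 * g b) + 13 * (a * b)\<^sup>2 * (1 - a * b)\<^sup>2 = 0"
    using y by simp
  moreover have "(b\<^sup>2 * g a - a * g b) * (b * g a - a\<^sup>2 * g b) + 13 * (a * b)\<^sup>2 * (1 - a * b)\<^sup>2
      = - (pq_relation a b * (1 - a * b)\<^sup>2)"
    unfolding g_def pq_relation_def by algebra
  ultimately show ?thesis by simp
qed

text \<open>The two sides have poles of order 1 and 4 at the cusp; multiplied by \<open>q^4\<close>,
  their difference tends to -1.\<close>

lemma hauptmodul13_not_invariant_4:
  "\<exists>\<tau>. Im \<tau> > 0 \<and> hauptmodul13 \<tau> \<noteq> hauptmodul13 (4 * \<tau>)"
proof -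
  let ?s = hauptmodul13_series
  have s: "(?s \<longlongrightarrow> 1) (at 0)"
    using DERIV_isCont[OF hauptmodul13_series_derivative_0] by (simp add: isCont_def)
  have "isCont ?s (0 ^ 4)"
    using DERIV_isCont[OF hauptmodul13_series_derivative_0] by simp
  moreover have "((\<lambda>q::complex. q ^ 4) \<longlongrightarrow> 0 ^ 4) (at 0)"
    by (intro tendsto_intros)
  ultimately have "((\<lambda>q. ?s (q ^ 4)) \<longlongrightarrow> ?s (0 ^ 4)) (at 0)"
    by (rule isCont_tendsto_compose)
  then have s4: "((\<lambda>q. ?s (q ^ 4)) \<longlongrightarrow> 1) (at 0)"
    by simp
  have "((\<lambda>q. q ^ 3 * ?s q - ?s (q ^ 4)) \<longlongrightarrow> 0 ^ 3 * 1 - 1) (at 0)"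
    by (intro tendsto_intros s s4)
  then have "((\<lambda>q. q ^ 3 * ?s q - ?s (q ^ 4)) \<longlongrightarrow> - 1) (at 0)" by simp
  then have "eventually (\<lambda>q. q ^ 3 * ?s q - ?s (q ^ 4) \<noteq> 0) (at 0)"
    by (rule tendsto_imp_eventually_ne) simp
  then obtain d where d: "d > 0" "\<And>q. q \<noteq> 0 \<Longrightarrow> norm q < d \<Longrightarrow> q ^ 3 * ?s q - ?s (q ^ 4) \<noteq> 0"
    by (auto simp: eventually_at)
  obtain Y where Y: "\<And>\<tau>. Im \<tau> > Y \<Longrightarrow> norm (nome \<tau>) < d"
    using norm_nome_small[OF d(1)] by blast
  define \<tau> where "\<tau> = Complex 0 (\<bar>Y\<bar> + 1)"
  have \<tau>: "Im \<tau> > Y" "Im \<tau> > 0" by (auto simp: \<tau>_def)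
  have "nome (4 * \<tau>) = nome \<tau> ^ 4" by (simp add: nome_power)
  then have "hauptmodul13 \<tau> \<noteq> hauptmodul13 (4 * \<tau>)"
    using d(2)[OF nome_nonzero Y[OF \<tau>(1)]]
    by (simp add: hauptmodul13_conv_series field_simps eval_nat_numeral)
  with \<tau>(2) show ?thesis by blast
qed

text \<open>The product \<open>a b\<close> telescopes to the quotient of the values at \<tau> and
  4\<tau>, so the extraneous factor is not identically 0 and the identity theorem removes it even at
  its zeros.\<close>

lemma pq_relation_hauptmodul13:
  assumes "Im \<tau> > 0"
  shows "pq_relation (hauptmodul13 \<tau> / hauptmodul13 (2 * \<tau>)) (hauptmodul13 (2 * \<tau>) / hauptmodul13 (4 * \<tau>)) = 0"
proof -
  let ?H = "{\<tau>. Im \<tau> > 0}"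
  define a where "a = (\<lambda>\<tau>. hauptmodul13 \<tau> / hauptmodul13 (2 * \<tau>))"
  define b where "b = (\<lambda>\<tau>. hauptmodul13 (2 * \<tau>) / hauptmodul13 (4 * \<tau>))"
  have hol: "a holomorphic_on ?H" "b holomorphic_on ?H"
    unfolding a_def b_def
    by (intro holomorphic_intros hauptmodul13_compose_holomorphic; simp add: hauptmodul13_nonzero)+
  have "pq_relation (a z) (b z) * (1 - a z * b z)\<^sup>2 = 0" if z: "Im z > 0" for z
  proof (rule modular_eq2_eliminate[where y = "hauptmodul13 (2 * z)"])
    show "modular_eq2 (a z * hauptmodul13 (2 * z)) (hauptmodul13 (2 * z)) = 0"
      using modular_equation_degree_2[OF z] z by (simp add: a_def hauptmodul13_nonzero)
    show "modular_eq2 (hauptmodul13 (2 * z)) (hauptmodul13 (2 * z) / b z) = 0"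
      using modular_equation_degree_2[of "2 * z"] z by (simp add: b_def hauptmodul13_nonzero)
  qed (use z in \<open>simp_all add: b_def hauptmodul13_nonzero\<close>)
  moreover have "(\<lambda>z. pq_relation (a z) (b z)) holomorphic_on ?H" "(\<lambda>z. (1 - a z * b z)\<^sup>2) holomorphic_on ?H"
    unfolding pq_relation_def by (intro holomorphic_intros hol)+
  ultimately have "(\<forall>z\<in>?H. pq_relation (a z) (b z) = 0) \<or> (\<forall>z\<in>?H. (1 - a z * b z)\<^sup>2 = 0)"
    by (intro holomorphic_mult_eq_0 open_upper_half_plane connected_upper_half_plane) simp_all
  moreover have "\<not> (\<forall>z\<in>?H. (1 - a z * b z)\<^sup>2 = 0)"
  proof -
    obtain z where z: "Im z > 0" "hauptmodul13 z \<noteq> hauptmodul13 (4 * z)"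
      using hauptmodul13_not_invariant_4 by blast
    then have "a z * b z \<noteq> 1"
      by (simp add: a_def b_def hauptmodul13_nonzero)
    then show ?thesis using z(1) by auto
  qed
  ultimately have "\<forall>z\<in>?H. pq_relation (a z) (b z) = 0" by blast
  then have "pq_relation (a \<tau>) (b \<tau>) = 0" using assms by simp
  then show ?thesis by (simp only: a_def b_def)
qed

theorem theorem3p1:
  fixes \<tau> q P Q :: complex
  assumes "Im \<tau> > 0"
    and "q = exp (2 * of_real pi * \<i> * \<tau>)"
    and "P = q_power \<tau> (1 / 2) * ramanujan_f (- q) * ramanujan_f (- (q ^ 26))
             / (ramanujan_f (- (q ^ 2)) * ramanujan_f (- (q ^ 13)))"
    and "Q = q * ramanujan_f (- (q ^ 2)) * ramanujan_f (- (q ^ 52))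
             / (ramanujan_f (- (q ^ 4)) * ramanujan_f (- (q ^ 26)))"
  shows "(P * Q + 1 / (P * Q)) ^ 2
       = (P * Q + 1 / (P * Q)) * ((P / Q + Q / P) ^ 3 + (P / Q + Q / P))
         - 4 * (P / Q + Q / P) ^ 2 + 4"
proof -
  define F where "F = (\<lambda>n::nat. qpochhammer_inf (q ^ n) (q ^ n))"
  have q: "q = nome \<tau>" using assms(2) by (simp add: nome_def)
  have norm_q: "norm q < 1" using assms(1) by (simp add: q)
  have F: "F n \<noteq> 0" if "n > 0" for n
    using that norm_q by (simp add: F_def qpochhammer_nonzero norm_power power_less_one_iff)
  have r: "(q_power \<tau> (1 / 2))\<^sup>2 = q"
    by (simp add: q_power_def q nome_def mult.assoc flip: exp_of_nat_mult)
  have P: "P = q_power \<tau> (1 / 2) * F 1 * F 26 / (F 2 * F 13)"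
    and Q: "Q = q * F 2 * F 52 / (F 4 * F 26)"
    using assms(3,4) by (simp_all add: ramanujan_f_def F_def)
  \<comment> \<open>The cases \<open>n = 1, 2, 4\<close> supply the three values whose quotients are
    \<open>P^2\<close> and \<open>Q^2\<close>.\<close>
  have h: "hauptmodul13 (of_nat n * \<tau>) = (F n / F (13 * n))\<^sup>2 / q ^ n" for n
  proof -
    have "nome (of_nat n * \<tau>) = q ^ n" by (simp add: q nome_power)
    then show ?thesis
      by (simp only: hauptmodul13_conv_series hauptmodul13_series_def F_def power_mult [symmetric]
          mult.commute [of 13 n])
  qed
  have nz: "q \<noteq> 0" "P \<noteq> 0" "Q \<noteq> 0"
    using F by (auto simp: P Q q q_power_def)
  have "P\<^sup>2 = q * (F 1 * F 26 / (F 2 * F 13))\<^sup>2"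
    unfolding P r [symmetric] by (simp add: power_mult_distrib power_divide)
  also have "\<dots> = ((F 1 / F 13)\<^sup>2 / q) / ((F 2 / F 26)\<^sup>2 / q\<^sup>2)"
    using nz(1) by (simp add: power_mult_distrib power_divide power2_eq_square mult_ac)
  finally have P2: "P\<^sup>2 = hauptmodul13 \<tau> / hauptmodul13 (2 * \<tau>)"
    using h[of 1] h[of 2] by simp
  have "Q\<^sup>2 = ((F 2 / F 26)\<^sup>2 / q\<^sup>2) / ((F 4 / F 52)\<^sup>2 / q ^ 4)"
    unfolding Q power4_eq_xxxx power2_eq_square using nz(1) by (simp add: mult_ac)
  then have Q2: "Q\<^sup>2 = hauptmodul13 (2 * \<tau>) / hauptmodul13 (4 * \<tau>)"
    using h[of 2] h[of 4] by simp
  have rel: "pq_relation (P\<^sup>2) (Q\<^sup>2) = 0"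
    unfolding P2 Q2 by (rule pq_relation_hauptmodul13[OF assms(1)])
  have T: "P * Q + 1 / (P * Q) = (P\<^sup>2 * Q\<^sup>2 + 1) / (P * Q)"
    and u: "P / Q + Q / P = (P\<^sup>2 + Q\<^sup>2) / (P * Q)"
    using nz by (simp_all add: field_simps power2_eq_square)
  \<comment> \<open>Both brackets have denominator \<open>P Q\<close>. Multiplication by its fourth
    power leaves only even powers of \<open>m = P Q\<close>, hence a polynomial in
    \<open>P^2\<close> and \<open>Q^2\<close>.\<close>
  have "((t / m)\<^sup>2 - (t / m * ((v / m) ^ 3 + v / m) - 4 * (v / m)\<^sup>2 + 4)) * m ^ 4
      = m\<^sup>2 * t\<^sup>2 - t * (v ^ 3 + v * m\<^sup>2) + 4 * v\<^sup>2 * m\<^sup>2 - 4 * m ^ 4" if "m \<noteq> 0" for t v m :: complex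
    using that by (simp add: field_simps eval_nat_numeral)
  from this[of "P * Q" "P\<^sup>2 * Q\<^sup>2 + 1" "P\<^sup>2 + Q\<^sup>2"]
  have "((P * Q + 1 / (P * Q))\<^sup>2 - ((P * Q + 1 / (P * Q)) * ((P / Q + Q / P) ^ 3 + (P / Q + Q / P))
      - 4 * (P / Q + Q / P)\<^sup>2 + 4)) * (P * Q) ^ 4 = pq_relation (P\<^sup>2) (Q\<^sup>2)"
    unfolding T u pq_relation_def using nz by (simp add: power_mult_distrib)
  with rel nz show ?thesis by simp
qed

end
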